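(* Let $$f(x)=Cx^Me^{\gamma x}\prod_{i=1}^\infty\frac{1+\alpha_i x}{1-\beta_i x},$$ regarded as a formal power series in $x$, where $C,\gamma,\alpha_i,\beta_i$ are nonnegative real numbers, $M\in\mathbb{N}$, and $\sum_{i=1}^\infty(\alpha_i+\beta_i)<\infty$. Define $r_n(t)$, $n\in\mathbb{N}$, by the formal power series expansion $$\frac{1}{1-t\,(f(x)-f(0))}=\sum_{n=0}^\infty r_n(t)x^n\in\mathbb{R}[t][[x]].$$ Then $r_n(t)$ is a real-rooted polynomial for each $n\in\mathbb{N}$, and the zeros of $r_n(t)$ interlace those of $r_{n+1}(t)$, i.e. $r_n(t)\prec r_{n+1}(t)$. Moreover, if $f(0)\ne0$, then all zeros of $r_n(t)$ lie in the interval $[-1/f(0),0]$ (unless $r_n$ is the zero polynomial).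
   Context: $\mathbb{N}=\{0,1,2,\dots\}$. Interlacing: let $f,g\in\mathbb{R}[t]$ be real-rooted with positive leading coefficients and zeros (with multiplicity) $\cdots\le\alpha_2\le\alpha_1$ and $\cdots\le\beta_2\le\beta_1$, respectively. Then $f\prec g$ ("the zeros of $f$ interlace those of $g$") means $\cdots\le\alpha_2\le\beta_2\le\alpha_1\le\beta_1$; in particular $\deg g\in\{\deg f,\deg f+1\}$. By convention $0\prec f$ and $f\prec 0$ for every real-rooted $f$, and the zero polynomial counts as real-rooted (also $0\prec0$). *)

theory Defs
  imports Complex_Main "HOL-Computational_Algebra.Computational_Algebra"
begin

section \<open>Real-rooted polynomials and interlacing\<close>

definition real_rooted :: "real poly \<Rightarrow> bool" where
  "real_rooted p \<longleftrightarrow>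
     p = 0 \<or> (\<forall>z. poly (map_poly complex_of_real p) z = 0 \<longrightarrow> z \<in> \<real>)"

text \<open>The real zeros with multiplicity, in weakly decreasing order.\<close>

definition zeros :: "real poly \<Rightarrow> real list" where
  "zeros p = rev (sorted_list_of_multiset (proots p))"

text \<open>
  For nonzero \<open>f\<close>, \<open>g\<close> with zeros \<open>\<alpha>\<^sub>1 \<ge> \<alpha>\<^sub>2 \<ge> \<dots>\<close> and \<open>\<beta>\<^sub>1 \<ge> \<beta>\<^sub>2 \<ge> \<dots>\<close> this is the chain
  \<open>\<dots> \<le> \<alpha>\<^sub>2 \<le> \<beta>\<^sub>2 \<le> \<alpha>\<^sub>1 \<le> \<beta>\<^sub>1\<close>: the condition \<open>\<alpha>\<^sub>i \<le> \<beta>\<^sub>i\<close> is imposed for every \<open>\<alpha>\<^sub>i\<close>, and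
  \<open>\<beta>\<^sub>i\<^sub>+\<^sub>1 \<le> \<alpha>\<^sub>i\<close> for every \<open>\<beta>\<^sub>i\<^sub>+\<^sub>1\<close>, that exists; the degree condition makes the remaining
  terms of these inequalities exist as well.
\<close>

definition interlaces :: "real poly \<Rightarrow> real poly \<Rightarrow> bool" (infix "\<prec>" 50) where
  "f \<prec> g \<longleftrightarrow>
     real_rooted f \<and> real_rooted g \<and>
     (f = 0 \<or> g = 0 \<or>
      lead_coeff f > 0 \<and> lead_coeff g > 0 \<and>
      (degree g = degree f \<or> degree g = degree f + 1) \<and>
      (\<forall>i < degree f. zeros f ! i \<le> zeros g ! i) \<and>
      (\<forall>i. i + 1 < degree g \<longrightarrow> zeros g ! (i + 1) \<le> zeros f ! i))"

lemma length_zeros: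
  assumes "real_rooted p" "p \<noteq> 0"
  shows "length (zeros p) = degree p"
proof -
  define P where "P = map_poly complex_of_real p"
  have P0: "P \<noteq> 0"
    using assms(2) by (simp add: P_def map_poly_eq_0_iff)
  have real_root: "z \<in> \<real>" if "z \<in># proots P" for z
    using that assms P0 by (auto simp: real_rooted_def P_def)
  define Q where "Q = smult (lead_coeff p) (\<Prod>x\<in>#proots P. [:- Re x, 1:])"
  have prod: "map_poly complex_of_real (\<Prod>x\<in>#M. [:- Re x, 1:]) = (\<Prod>x\<in>#M. [:- x, 1:])"
    if "\<And>x. x \<in># M \<Longrightarrow> x \<in> \<real>" for M
    using that
  proof (induction M)
    case (add x M)
    have hom: "map_poly complex_of_real (a * b)
        = map_poly complex_of_real a * map_poly complex_of_real b" for a b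
      by (rule poly_eqI) (simp add: coeff_map_poly coeff_mult)
    have "map_poly complex_of_real [:- Re x, 1:] = [:- x, 1:]"
      using add.prems[of x] by (simp add: map_poly_pCons of_real_Re)
    moreover have "map_poly complex_of_real (\<Prod>x\<in>#M. [:- Re x, 1:]) = (\<Prod>x\<in>#M. [:- x, 1:])"
      using add by simp
    ultimately show ?case
      using hom[of "[:- Re x, 1:]" "\<Prod>x\<in>#M. [:- Re x, 1:]"]
      unfolding image_mset_add_mset prod_mset.add_mset by metis
  qed auto
  have "map_poly complex_of_real Q = smult (lead_coeff P) (\<Prod>x\<in>#proots P. [:- x, 1:])"
  proof -
    have "map_poly complex_of_real (smult c a)
        = smult (of_real c) (map_poly complex_of_real a)" for c a
      by (rule poly_eqI) (simp add: coeff_map_poly)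
    then show ?thesis
      unfolding Q_def using prod[OF real_root]
      by (simp add: P_def degree_map_poly coeff_map_poly)
  qed
  also have "\<dots> = P"
    by (rule complex_poly_decompose_multiset)
  finally have "Q = p"
    unfolding P_def poly_eq_iff by (simp add: coeff_map_poly)
  moreover have "size (proots Q) = size (proots P)"
  proof -
    have "proots (\<Prod>x\<in>#M. [:- Re x, 1:]) = image_mset Re M" for M :: "complex multiset"
    proof (induction M)
      case (add x M)
      have "(\<Prod>x\<in>#M. [:- Re x, 1:]) \<noteq> 0"
        by (subst prod_mset_zero_iff) auto
      then have "proots ([:- Re x, 1:] * (\<Prod>x\<in>#M. [:- Re x, 1:])) = {#Re x#} + image_mset Re M"
        using add by (subst proots_mult) auto
      then show ?case by simp
    qed auto
    then show ?thesis using assms(2) by (simp add: Q_def)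
  qed
  ultimately show ?thesis
    using size_proots_complex[of P]
    by (simp add: zeros_def P_def degree_map_poly flip: size_mset)
qed


section \<open>Infinite products of formal power series\<close>

text \<open>
  The product is the coefficientwise limit, in the usual topology of \<^typ>\<open>real\<close>, of the
  partial products.  (In the metric that the library puts on \<^typ>\<open>real fps\<close>, the
  \<open>X\<close>-adic one, the products considered here need not converge.)
\<close>

definition fps_infprod :: "(nat \<Rightarrow> real fps) \<Rightarrow> real fps" where
  "fps_infprod F = Abs_fps (\<lambda>n. lim (\<lambda>N. fps_nth (\<Prod>i<N. F i) n))"

lemma fps_linear_quotient:
  fixes a b :: real
  shows "(1 + fps_const a * fps_X) / (1 - fps_const b * fps_X)
       = Abs_fps (\<lambda>k. if k = 0 then 1 else (a + b) * b ^ (k - 1))" (is "?p / ?q = ?G")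
proof -
  have "?G * ?q = ?p"
  proof (rule fps_ext)
    fix n
    have eq: "?G * ?q = ?G - fps_const b * (fps_X * ?G)"
      by (simp add: algebra_simps)
    show "fps_nth (?G * ?q) n = fps_nth ?p n"
      unfolding eq by (cases n; cases "n - 1") (auto simp: algebra_simps)
  qed
  moreover have "fps_nth ?q 0 \<noteq> 0"
    by simp
  then have "?q \<noteq> 0"
    by (metis fps_zero_nth)
  ultimately show ?thesis
    using nonzero_mult_div_cancel_right[of ?q ?G] by simp
qed

lemma fps_infprod_LIMSEQ:
  fixes \<alpha> \<beta> :: "nat \<Rightarrow> real"
  assumes nonneg: "\<And>i. \<alpha> i \<ge> 0" "\<And>i. \<beta> i \<ge> 0"
    and summable: "summable (\<lambda>i. \<alpha> i + \<beta> i)"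
  defines "F \<equiv> (\<lambda>i. (1 + fps_const (\<alpha> i) * fps_X) / (1 - fps_const (\<beta> i) * fps_X))"
  shows "(\<lambda>N. fps_nth (\<Prod>i<N. F i) n) \<longlonglongrightarrow> fps_nth (fps_infprod F) n"
proof -
  let ?P = "\<lambda>N. \<Prod>i<N. F i" and ?s = "\<lambda>i. \<alpha> i + \<beta> i"
  have F0: "fps_nth (F i) 0 = 1" for i
    by (simp add: F_def fps_linear_quotient)
  have F_ge: "0 \<le> fps_nth (F i) k" for i k
    using nonneg by (simp add: F_def fps_linear_quotient)
  have F_le: "fps_nth (F i) k \<le> ?s i ^ k" for i k
    using nonneg by (cases k) (auto simp: F_def fps_linear_quotient intro!: mult_left_mono power_mono)
  have P_ge: "0 \<le> fps_nth (?P N) k" for N k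
    by (induction N arbitrary: k) (auto simp: fps_mult_nth F_ge intro!: sum_nonneg)
  have step: "fps_nth (?P N) k \<le> fps_nth (?P (Suc N)) k" for N k
  proof -
    have "fps_nth (?P N) k * fps_nth (F N) (k - k)
        \<le> (\<Sum>i=0..k. fps_nth (?P N) i * fps_nth (F N) (k - i))"
      by (rule member_le_sum) (auto intro!: mult_nonneg_nonneg P_ge F_ge)
    then show ?thesis by (simp add: fps_mult_nth F0)
  qed
  have P_le: "fps_nth (?P N) k \<le> (\<Sum>i<N. ?s i) ^ k" for N k
  proof (induction N arbitrary: k)
    case (Suc N)
    let ?S = "\<Sum>i<N. ?s i"
    have S: "?S \<ge> 0" using nonneg by (intro sum_nonneg) auto
    have s: "?s N \<ge> 0" using nonneg by simp
    have "fps_nth (?P (Suc N)) k = (\<Sum>i=0..k. fps_nth (?P N) i * fps_nth (F N) (k - i))"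
      by (simp add: fps_mult_nth)
    also have "\<dots> \<le> (\<Sum>i=0..k. real (k choose i) * ?S ^ i * ?s N ^ (k - i))"
    proof (rule sum_mono)
      fix i assume "i \<in> {0..k}"
      then have "1 \<le> real (k choose i)" by (simp add: Suc_leI)
      have le: "fps_nth (?P N) i * fps_nth (F N) (k - i) \<le> ?S ^ i * ?s N ^ (k - i)"
        by (intro mult_mono Suc.IH F_le F_ge zero_le_power S)
      also have "\<dots> \<le> real (k choose i) * (?S ^ i * ?s N ^ (k - i))"
        using mult_right_mono[OF \<open>1 \<le> real (k choose i)\<close>, of "?S ^ i * ?s N ^ (k - i)"] S s
        by simp
      finally show "fps_nth (?P N) i * fps_nth (F N) (k - i)
          \<le> real (k choose i) * ?S ^ i * ?s N ^ (k - i)"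
        by (simp add: mult.assoc)
    qed
    also have "\<dots> = (?S + ?s N) ^ k"
      by (simp only: binomial_ring atLeast0AtMost)
    finally show ?case by simp
  qed (cases "k = 0"; simp)
  have "fps_nth (?P N) n \<le> (\<Sum>i. ?s i) ^ n" for N
  proof -
    have "(\<Sum>i<N. ?s i) \<le> (\<Sum>i. ?s i)"
      using nonneg by (intro sum_le_suminf summable) auto
    moreover have "0 \<le> (\<Sum>i<N. ?s i)"
      using nonneg by (intro sum_nonneg) auto
    ultimately show ?thesis
      using P_le[of N n] power_mono order_trans by blast
  qed
  moreover have "incseq (\<lambda>N. fps_nth (?P N) n)"
    by (rule incseq_SucI) (rule step)
  ultimately have "convergent (\<lambda>N. fps_nth (?P N) n)"
    by (meson incseq_convergent convergentI)
  then show ?thesis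
    by (simp add: fps_infprod_def convergent_LIMSEQ_iff)
qed


section \<open>The expansion of $1/(1 - t\,(f(x) - f(0)))$\<close>

text \<open>
  Elements of \<open>\<real>[t][[x]]\<close> are represented in \<^typ>\<open>real poly fps\<close>: the polynomial variable is
  \<open>t\<close>, the power series variable \<open>x\<close>.
\<close>

definition lift_fps :: "real fps \<Rightarrow> real poly fps" where
  "lift_fps f = Abs_fps (\<lambda>n. [:fps_nth f n:])"

definition denom :: "real fps \<Rightarrow> real poly fps" where
  "denom f = 1 - fps_const [:0, 1:] * lift_fps (f - fps_const (fps_nth f 0))"

text \<open>
  The inverse of \<^term>\<open>denom f\<close>.  Since \<^typ>\<open>real poly\<close> is not of class \<open>inverse\<close>, the
  operation \<open>inverse\<close> is not available on \<^typ>\<open>real poly fps\<close>, and the inverse of the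
  constant term of \<^term>\<open>denom f\<close>, which is 1, has to be supplied explicitly.
\<close>

definition r_series :: "real fps \<Rightarrow> real poly fps" where
  "r_series f = fps_right_inverse (denom f) 1"

lemma r_series_unique: "denom f * R = 1 \<longleftrightarrow> R = r_series f"
proof -
  have "denom f * r_series f = 1"
    unfolding r_series_def by (rule fps_right_inverse) (simp add: denom_def lift_fps_def)
  then have "R = r_series f" if "denom f * R = 1"
    using that by (metis (no_types) mult.assoc mult.commute mult_1)
  with \<open>denom f * r_series f = 1\<close> show ?thesis by blast
qed

end

theory Submission
  imports Defs "HOL-Complex_Analysis.Complex_Analysis"
begin

text \<open>
  If \<open>C > 0\<close>, then \<open>f\<close> is a coefficientwise limit of finite products \<open>c \<Prod>\<^sub>i\<^sub><\<^sub>m (1 + \<alpha>\<^sub>i x) / (1 - \<beta>\<^sub>i x)\<close> with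
  \<open>c > 0\<close>.  For such a product let \<open>w\<^sub>n\<^sub>,\<^sub>j\<close> be the coefficient of \<open>x\<^sup>n\<close> in
  \<open>g\<^sub>j / (1 - t (f - c))\<close>, where \<open>g\<^sub>j\<close> is the product of the first \<open>j\<close> factors.  Then
  \<open>w\<^sub>n\<^sub>+\<^sub>1\<^sub>,\<^sub>j = (1 + c t) (u\<^sub>0 + \<dots> + u\<^sub>j\<^sub>-\<^sub>1) + c t (u\<^sub>j + \<dots> + u\<^sub>m\<^sub>-\<^sub>1)\<close> with
  \<open>u\<^sub>i = \<alpha>\<^sub>i w\<^sub>n\<^sub>,\<^sub>i + \<beta>\<^sub>i w\<^sub>n\<^sub>,\<^sub>i\<^sub>+\<^sub>1\<close>.  It follows by induction on \<open>n\<close> that at every point \<open>t\<close> of the upper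
  half-plane the arguments of \<open>w\<^sub>n\<^sub>,\<^sub>0, \<dots>, w\<^sub>n\<^sub>,\<^sub>m\<close> decrease and span at most the argument of
  \<open>c t / (1 + c t)\<close>, which is less than \<open>\<pi>\<close>.  Hence \<open>r\<^sub>n = w\<^sub>n\<^sub>,\<^sub>0\<close> has no zero there, and the
  imaginary part of \<open>r\<^sub>n\<^sub>+\<^sub>1\<close> times the conjugate of \<open>r\<^sub>n\<close> is nonnegative.  The first property
  passes to the limit by Hurwitz's theorem, the second trivially, and for real-rooted
  polynomials the second one is interlacing.
\<close>

section \<open>Interlacing in terms of the upper half-plane\<close>

abbreviation cpoly :: "real poly \<Rightarrow> complex \<Rightarrow> complex" where
  "cpoly p \<equiv> poly (map_poly complex_of_real p)"

lemma map_poly_of_real_add: "map_poly complex_of_real (p + q) = map_poly of_real p + map_poly of_real q"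
  by (rule poly_eqI) (simp add: coeff_map_poly)

lemma map_poly_of_real_mult: "map_poly complex_of_real (p * q) = map_poly of_real p * map_poly of_real q"
  by (rule poly_eqI) (simp add: coeff_map_poly coeff_mult)

lemma map_poly_of_real_smult: "map_poly complex_of_real (smult a p) = smult (of_real a) (map_poly of_real p)"
  by (rule poly_eqI) (simp add: coeff_map_poly)

lemma cpoly_simps [simp]:
  "cpoly (p + q) z = cpoly p z + cpoly q z"
  "cpoly (p * q) z = cpoly p z * cpoly q z"
  "cpoly (smult a p) z = of_real a * cpoly p z"
  by (simp_all add: map_poly_of_real_add map_poly_of_real_mult map_poly_of_real_smult)

lemma cpoly_sum: "cpoly (sum p A) z = (\<Sum>i\<in>A. cpoly (p i) z)"
  by (induction A rule: infinite_finite_induct) auto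

lemma cpoly_of_real: "cpoly p (of_real x) = of_real (poly p x)"
  by (induction p) (auto simp: map_poly_pCons)

lemma cpoly_cnj: "cpoly p (cnj z) = cnj (cpoly p z)"
  by (induction p) (auto simp: map_poly_pCons)

lemma cpoly_altdef:
  assumes "degree p \<le> n"
  shows "cpoly p z = (\<Sum>k\<le>n. of_real (coeff p k) * z ^ k)"
proof -
  have "degree (map_poly complex_of_real p) \<le> n"
    using assms by (simp add: degree_map_poly)
  then have "cpoly p z = (\<Sum>k\<le>n. coeff (map_poly complex_of_real p) k * z ^ k)"
    unfolding poly_altdef
    by (intro sum.mono_neutral_left) (auto simp: coeff_eq_0)
  then show ?thesis by (simp add: coeff_map_poly)
qed

text \<open>Nonreal zeros of a real polynomial come in conjugate pairs, so the upper half-plane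
  suffices. This open connected set is the form in which Hurwitz's theorem applies.\<close>

lemma real_rooted_iff_upper:
  "real_rooted p \<longleftrightarrow> p = 0 \<or> (\<forall>z. Im z > 0 \<longrightarrow> cpoly p z \<noteq> 0)"
proof -
  have "z \<in> \<real>" if up: "\<forall>z. Im z > 0 \<longrightarrow> cpoly p z \<noteq> 0" and z: "cpoly p z = 0" for z
  proof -
    have "\<not> Im z > 0" using up z by blast
    moreover have "\<not> Im (cnj z) > 0" using up z cpoly_cnj[of p z] by force
    ultimately show ?thesis by (simp add: complex_is_Real_iff)
  qed
  then show ?thesis
    unfolding real_rooted_def by (auto simp: complex_is_Real_iff)
qed

section \<open>Factorization and argument of a real-rooted polynomial\<close>

lemma prod_linear_factors_dvd:
  fixes p :: "'a::field poly"
  assumes "p \<noteq> 0" "A \<subseteq># proots p"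
  shows "(\<Prod>x\<in>#A. [:-x, 1:]) dvd p"
  using assms(2)
proof (induction A)
  case (add x A)
  then obtain q where q: "p = (\<Prod>x\<in>#A. [:-x, 1:]) * q"
    using subset_mset.dual_order.trans[OF add.prems, of A] by (auto simp: dvd_def)
  have "(\<Prod>x\<in>#A. [:-x, 1:]) \<noteq> 0" "q \<noteq> 0"
    using q assms(1) by auto
  moreover have "proots (\<Prod>x\<in>#A. [:-x, 1:]) = A"
  proof (induction A)
    case (add x A)
    have "(\<Prod>x\<in>#A. [:-x, 1:]) \<noteq> 0" by (subst prod_mset_zero_iff) auto
    then have "proots ([:-x, 1:] * (\<Prod>x\<in>#A. [:-x, 1:])) = {#x#} + A"
      using add by (subst proots_mult) auto
    then show ?case by simp
  qed auto
  \<comment> \<open>The product accounts for exactly \<open>A\<close>, so the additional copy of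
    \<open>x\<close> is a zero of the cofactor \<open>q\<close>, even if \<open>x\<close> already
    occurs in \<open>A\<close>.\<close>
  ultimately have "proots p = A + proots q"
    unfolding q by (subst proots_mult) auto
  with add.prems have "x \<in># proots q"
    by (metis add_mset_add_single single_subset_iff subset_mset.add_le_cancel_left)
  then have "[:-x, 1:] dvd q"
    using \<open>q \<noteq> 0\<close> by (simp add: poly_eq_0_iff_dvd)
  then show ?case
    unfolding q image_mset_add_mset prod_mset.add_mset
    by (metis dvd_refl mult.commute mult_dvd_mono)
qed auto

text \<open>By \<open>length_zeros\<close> the real zeros exhaust the degree, so the product of the
  linear factors divides \<open>p\<close> with a constant cofactor.\<close>

lemma real_rooted_decompose:
  assumes "real_rooted p" "p \<noteq> 0"
  shows "p = smult (lead_coeff p) (\<Prod>x\<in>#proots p. [:-x, 1:])"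
proof -
  let ?D = "\<Prod>x\<in>#proots p. [:-x, 1:]"
  have size: "size (proots p) = degree p"
    using length_zeros[OF assms] by (simp add: zeros_def flip: size_mset)
  have D: "degree (\<Prod>x\<in>#A. [:-x, 1:]) = size A \<and> lead_coeff (\<Prod>x\<in>#A. [:-x, 1:]) = 1"
    for A :: "real multiset"
  proof (induction A)
    case (add x A)
    have "(\<Prod>x\<in>#A. [:-x, 1:]) \<noteq> 0" by (subst prod_mset_zero_iff) auto
    then have "degree ([:-x, 1:] * (\<Prod>x\<in>#A. [:-x, 1:])) = size (add_mset x A)"
      using add by (subst degree_mult_eq) auto
    moreover have "lead_coeff ([:-x, 1:] * (\<Prod>x\<in>#A. [:-x, 1:])) = 1"
      using add by (subst lead_coeff_mult) auto
    ultimately show ?case unfolding image_mset_add_mset prod_mset.add_mset by blast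
  qed auto
  obtain q where q: "p = ?D * q"
    using prod_linear_factors_dvd[OF assms(2), of "proots p"] by (auto simp: dvd_def)
  have "q \<noteq> 0" "?D \<noteq> 0" using q assms(2) by auto
  then have "degree p = degree ?D + degree q"
    by (metis degree_mult_eq q)
  then have "degree q = 0" using D[of "proots p"] size by simp
  moreover have "lead_coeff q = lead_coeff p"
    using D[of "proots p"] by (metis lead_coeff_mult mult_1 q)
  ultimately have "q = [:lead_coeff p:]"
    by (metis degree_eq_zeroE lead_coeff_pCons(2) )
  then show ?thesis using q by (simp add: mult.commute)
qed

text \<open>The argument of \<open>p (a + i b)\<close>, as a sum over the zeros of \<open>p\<close>.\<close>

definition half_arg :: "real poly \<Rightarrow> real \<Rightarrow> real \<Rightarrow> real" where
  "half_arg p a b = (\<Sum>x\<in>#proots p. pi / 2 - arctan ((a - x) / b))"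

text \<open>\<open>pi / 2 - arctan u\<close> is the inverse cotangent with values between 0 and
  \<open>pi\<close>. It gives a branch of the argument of \<open>Complex a b - x\<close> that is
  continuous in \<open>a\<close>, and \<open>R\<close> is the modulus.\<close>

lemma linear_polar:
  assumes "b > 0"
  shows "\<exists>R>0. Complex a b - of_real x = of_real R * cis (pi / 2 - arctan ((a - x) / b))"
proof (intro exI conjI)
  let ?u = "(a - x) / b" and ?R = "b * sqrt (1 + ((a - x) / b)\<^sup>2)"
  have "1 + ?u\<^sup>2 > 0"
    by (simp add: add_pos_nonneg)
  then have pos: "sqrt (1 + ?u\<^sup>2) > 0" "1 + ?u\<^sup>2 \<noteq> 0"
    by auto
  show "?R > 0" using assms pos by simp
  show "Complex a b - of_real x = of_real ?R * cis (pi / 2 - arctan ?u)"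
    using assms pos
    by (simp add: complex_eq_iff cos_diff sin_diff sin_arctan cos_arctan del: real_sqrt_gt_0_iff)
qed

text \<open>The arguments of the linear factors add up; a positive leading coefficient contributes
  nothing to them.\<close>

lemma cpoly_polar:
  assumes "real_rooted p" "p \<noteq> 0" "lead_coeff p > 0" "b > 0"
  shows "\<exists>R>0. cpoly p (Complex a b) = of_real R * cis (half_arg p a b)"
proof -
  have "\<exists>R>0. cpoly (\<Prod>x\<in>#A. [:-x, 1:]) (Complex a b)
      = of_real R * cis (\<Sum>x\<in>#A. pi / 2 - arctan ((a - x) / b))" for A
  proof (induction A)
    case (add x A)
    then obtain R where R: "R > 0" "cpoly (\<Prod>x\<in>#A. [:-x, 1:]) (Complex a b)
      = of_real R * cis (\<Sum>x\<in>#A. pi / 2 - arctan ((a - x) / b))" by blast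
    obtain S where S: "S > 0"
        "Complex a b - of_real x = of_real S * cis (pi / 2 - arctan ((a - x) / b))"
      using linear_polar[OF assms(4)] by blast
    have "cpoly [:-x, 1:] (Complex a b) = Complex a b - of_real x"
      by (simp add: map_poly_pCons)
    then have "cpoly ([:-x, 1:] * (\<Prod>x\<in>#A. [:-x, 1:])) (Complex a b)
      = of_real (S * R) * cis (\<Sum>x\<in>#add_mset x A. pi / 2 - arctan ((a - x) / b))"
      unfolding cpoly_simps R S by (simp flip: cis_mult)
    then show ?case using R S by (intro exI[of _ "S * R"]) simp
  qed (auto intro!: exI[of _ 1])
  then obtain R where R: "R > 0" "cpoly (\<Prod>x\<in>#proots p. [:-x, 1:]) (Complex a b)
      = of_real R * cis (half_arg p a b)"
    unfolding half_arg_def by blast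
  then have "cpoly p (Complex a b) = of_real (lead_coeff p * R) * cis (half_arg p a b)"
    by (subst real_rooted_decompose[OF assms(1,2)]) simp
  then show ?thesis using R assms(3) by (intro exI[of _ "lead_coeff p * R"]) simp
qed

lemma half_arg_at_top:
  assumes "b > 0"
  shows "((\<lambda>a. half_arg p a b) \<longlongrightarrow> 0) at_top"
proof -
  have "((\<lambda>a. pi / 2 - arctan ((a - x) / b)) \<longlongrightarrow> 0) at_top" for x
    using assms by real_asymp
  then have "((\<lambda>a. \<Sum>x\<in>#A. pi / 2 - arctan ((a - x) / b)) \<longlongrightarrow> 0) at_top" for A
    by (induction A) (auto intro: tendsto_add_zero)
  then show ?thesis unfolding half_arg_def .
qed

text \<open>As the point descends to the real axis, the factor of a zero to the right of
  \<open>a\<close> acquires the argument \<open>pi\<close>, that of a zero to the left the argument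
  0. The limit therefore counts the zeros above \<open>a\<close>.\<close>

lemma half_arg_at_right_0:
  assumes "poly p a \<noteq> 0"
  shows "((\<lambda>b. half_arg p a b) \<longlongrightarrow> pi * size (filter_mset (\<lambda>x. a < x) (proots p))) (at_right 0)"
proof -
  have lim: "((\<lambda>b. pi / 2 - arctan ((a - x) / b)) \<longlongrightarrow> (if a < x then pi else 0)) (at_right 0)"
    if "x \<noteq> a" for x
  proof (cases "a < x")
    case True
    then have "((\<lambda>b. pi / 2 - arctan ((a - x) / b)) \<longlongrightarrow> pi) (at_right 0)" by real_asymp
    with True show ?thesis by simp
  next
    case False
    with that have "a - x > 0" by simp
    then have "((\<lambda>b. pi / 2 - arctan ((a - x) / b)) \<longlongrightarrow> 0) (at_right 0)" by real_asymp
    with False show ?thesis by simp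
  qed
  have "((\<lambda>b. \<Sum>x\<in>#A. pi / 2 - arctan ((a - x) / b))
      \<longlongrightarrow> pi * size (filter_mset (\<lambda>x. a < x) A)) (at_right 0)" if "a \<notin># A" for A
    using that
  proof (induction A)
    case (add x A)
    then have "((\<lambda>b. (pi / 2 - arctan ((a - x) / b)) + (\<Sum>x\<in>#A. pi / 2 - arctan ((a - x) / b)))
      \<longlongrightarrow> (if a < x then pi else 0) + pi * size (filter_mset (\<lambda>x. a < x) A)) (at_right 0)"
      by (intro tendsto_add lim) auto
    then show ?case by (auto simp: algebra_simps)
  qed auto
  moreover have "a \<notin># proots p"
    using assms by (cases "p = 0") auto
  ultimately show ?thesis unfolding half_arg_def by blast
qed

lemma continuous_half_arg: "b > 0 \<Longrightarrow> continuous_on S (\<lambda>a. half_arg p a b)"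
proof -
  assume "b > 0"
  then have "continuous_on S (\<lambda>a. \<Sum>x\<in>#A. pi / 2 - arctan ((a - x) / b))" for A
    by (induction A) (auto intro!: continuous_intros)
  then show ?thesis unfolding half_arg_def .
qed

text \<open>On a horizontal line the difference of the arguments is continuous, tends to 0 to the right and
  has nonnegative sine, so that it never leaves the interval from 0 to \<open>\<pi>\<close>.\<close>

lemma half_arg_diff_bounds:
  assumes p: "real_rooted p" "p \<noteq> 0" "lead_coeff p > 0"
    and q: "real_rooted q" "q \<noteq> 0" "lead_coeff q > 0"
    and pq: "\<And>z. Im z > 0 \<Longrightarrow> Im (cpoly q z * cnj (cpoly p z)) \<ge> 0"
    and b: "b > 0"
  shows "half_arg q a b - half_arg p a b \<in> {0..pi}"
proof -
  define \<phi> where "\<phi> a = half_arg q a b - half_arg p a b" for a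
  have sin: "sin (\<phi> a) \<ge> 0" for a
  proof -
    obtain R where R: "R > 0" "cpoly p (Complex a b) = of_real R * cis (half_arg p a b)"
      using cpoly_polar[OF p b] by blast
    obtain S where S: "S > 0" "cpoly q (Complex a b) = of_real S * cis (half_arg q a b)"
      using cpoly_polar[OF q b] by blast
    have "S * R * sin (\<phi> a) = Im (cpoly q (Complex a b) * cnj (cpoly p (Complex a b)))"
      unfolding R S \<phi>_def by (simp add: sin_diff algebra_simps)
    also have "\<dots> \<ge> 0"
      using pq b by simp
    finally show ?thesis using mult_pos_pos[OF S(1) R(1)] by (simp add: zero_le_mult_iff)
  qed
  have lim: "(\<phi> \<longlongrightarrow> 0) at_top"
    using tendsto_diff[OF half_arg_at_top[OF b, of q] half_arg_at_top[OF b, of p]]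
    unfolding \<phi>_def by simp
  have cont: "continuous_on S \<phi>" for S
    unfolding \<phi>_def by (intro continuous_intros continuous_half_arg b)
  have "eventually (\<lambda>c. \<bar>\<phi> c\<bar> < pi / 2) at_top"
    using lim[THEN tendstoD, of "pi / 2"] pi_gt_zero by (simp add: dist_real_def)
  then have "eventually (\<lambda>c. \<bar>\<phi> c\<bar> < pi / 2 \<and> c \<ge> a) at_top"
    using eventually_ge_at_top eventually_conj by blast
  \<comment> \<open>At \<open>c\<close>, to the right of \<open>a\<close>, the function
    \<open>\<phi>\<close> is already close to its limit 0; both intermediate value arguments below
    run between \<open>a\<close> and \<open>c\<close>.\<close>
  then obtain c where c: "\<bar>\<phi> c\<bar> < pi / 2" "c \<ge> a"
    using eventually_happens trivial_limit_at_top_linorder by blast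
  have "sin (\<phi> c) \<ge> 0" using sin .
  have "\<phi> a \<ge> 0"
  proof (rule ccontr)
    assume neg: "\<not> \<phi> a \<ge> 0"
    \<comment> \<open>A value far below 0 may have nonnegative sine by periodicity. In that case
      \<open>\<phi>\<close> passes through \<open>- (pi / 2)\<close> on its way to \<open>c\<close>,
      and there the sine is negative.\<close>
    have "\<exists>d. \<phi> d < 0 \<and> \<phi> d \<ge> - (pi / 2)"
    proof (cases "\<phi> a \<ge> - (pi / 2)")
      case False
      moreover have "\<phi> c \<ge> - (pi / 2)"
        using c(1) by linarith
      ultimately obtain d where "\<phi> d = - (pi / 2)"
        using c IVT'[of \<phi> a "- (pi / 2)" c, OF _ _ _ cont] by (metis linear)
      then show ?thesis by (intro exI[of _ d]) simp
    qed (use neg in \<open>auto intro!: exI[of _ a]\<close>)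
    then obtain d where "\<phi> d < 0" "\<phi> d \<ge> - (pi / 2)" by blast
    then have "sin (- \<phi> d) > 0" using pi_gt_zero by (intro sin_gt_zero) linarith+
    with sin[of d] show False by simp
  qed
  moreover have "\<phi> a \<le> pi"
  proof (rule ccontr)
    assume big: "\<not> \<phi> a \<le> pi"
    \<comment> \<open>The same device at the upper end, with \<open>3 * pi / 2\<close> as the value
      that is passed.\<close>
    have "\<exists>d. \<phi> d > pi \<and> \<phi> d \<le> 3 * pi / 2"
    proof (cases "\<phi> a \<le> 3 * pi / 2")
      case False
      moreover have "\<phi> c \<le> 3 * pi / 2"
        using c(1) pi_gt_zero by linarith
      ultimately obtain d where "\<phi> d = 3 * pi / 2"
        using c IVT2'[of \<phi> c "3 * pi / 2" a, OF _ _ _ cont] by (metis linear)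
      then show ?thesis using pi_gt_zero by (intro exI[of _ d] conjI) linarith+
    qed (use big in \<open>auto intro!: exI[of _ a]\<close>)
    then obtain d where "\<phi> d > pi" "\<phi> d \<le> 3 * pi / 2" by blast
    then have "sin (\<phi> d) < 0" using pi_gt_zero by (intro sin_lt_zero) linarith+
    with sin[of d] show False by simp
  qed
  ultimately show ?thesis unfolding \<phi>_def by simp
qed

section \<open>Interlacing by counting zeros\<close>

definition zeros_above :: "real poly \<Rightarrow> real \<Rightarrow> nat" where
  "zeros_above p a = size (filter_mset (\<lambda>x. a < x) (proots p))"

text \<open>Let \<open>b\<close> tend to 0 in \<open>half_arg_diff_bounds\<close>: the difference of
  the arguments tends to \<open>pi\<close> times the difference of the counts and stays between 0
  and \<open>pi\<close>.\<close>

lemma zeros_above_bounds: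
  assumes p: "real_rooted p" "p \<noteq> 0" "lead_coeff p > 0"
    and q: "real_rooted q" "q \<noteq> 0" "lead_coeff q > 0"
    and pq: "\<And>z. Im z > 0 \<Longrightarrow> Im (cpoly q z * cnj (cpoly p z)) \<ge> 0"
    and a: "poly p a \<noteq> 0" "poly q a \<noteq> 0"
  shows "zeros_above p a \<le> zeros_above q a" "zeros_above q a \<le> zeros_above p a + 1"
proof -
  let ?d = "\<lambda>b. half_arg q a b - half_arg p a b"
  have lim: "(?d \<longlongrightarrow> pi * zeros_above q a - pi * zeros_above p a) (at_right 0)"
    unfolding zeros_above_def by (intro tendsto_diff half_arg_at_right_0 a)
  have ev: "eventually (\<lambda>b. ?d b \<in> {0..pi}) (at_right 0)"
    using half_arg_diff_bounds[OF p q pq] by (auto simp: eventually_at_filter)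
  have "pi * zeros_above q a - pi * zeros_above p a \<in> {0..pi}"
    by (rule Lim_in_closed_set[OF _ ev _ lim]) auto
  then have "pi * real (zeros_above p a) \<le> pi * real (zeros_above q a)"
    "pi * real (zeros_above q a) \<le> pi * (real (zeros_above p a) + 1)"
    by (auto simp: algebra_simps)
  then show "zeros_above p a \<le> zeros_above q a" "zeros_above q a \<le> zeros_above p a + 1"
    by (auto simp del: of_nat_Suc simp flip: of_nat_Suc)
qed

text \<open>The list decreases, so its entries above \<open>a\<close> form an initial segment of
  length \<open>zeros_above p a\<close>; positions start at 0.\<close>

lemma nth_zeros_gt_iff:
  assumes "i < length (zeros p)"
  shows "zeros p ! i > a \<longleftrightarrow> i < zeros_above p a"
proof -
  let ?L = "zeros p" and ?l = "sorted_list_of_multiset (proots p)"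
  have sorted: "sorted_wrt (\<ge>) ?L"
    unfolding zeros_def by (simp add: sorted_wrt_rev)
  have N: "zeros_above p a = card {j. j < length ?L \<and> ?L ! j > a}"
  proof -
    have "zeros_above p a = size (filter_mset (\<lambda>x. a < x) (mset ?L))"
      by (simp add: zeros_above_def zeros_def)
    also have "\<dots> = length (filter (\<lambda>x. a < x) ?L)"
      by (metis mset_filter size_mset)
    finally show ?thesis by (simp add: length_filter_conv_card)
  qed
  have mono: "?L ! j \<le> ?L ! k" if "k \<le> j" "j < length ?L" for j k
    using sorted that by (cases "k = j") (auto simp: sorted_wrt_iff_nth_less)
  show ?thesis
  proof
    assume "zeros p ! i > a"
    then have "{..i} \<subseteq> {j. j < length ?L \<and> ?L ! j > a}"
      using assms mono by (force intro: less_le_trans)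
    then have "card {..i} \<le> zeros_above p a"
      unfolding N by (intro card_mono) auto
    then show "i < zeros_above p a" by simp
  next
    assume i: "i < zeros_above p a"
    show "zeros p ! i > a"
    proof (rule ccontr)
      assume "\<not> zeros p ! i > a"
      then have "{j. j < length ?L \<and> ?L ! j > a} \<subseteq> {..<i}"
        using mono assms by (metis (no_types, lifting) lessThan_iff linorder_not_less mem_Collect_eq
            order_less_le_trans subsetI)
      then have "zeros_above p a \<le> card {..<i}"
        unfolding N by (intro card_mono) auto
      with i show False by simp
    qed
  qed
qed

lemma ex_nonroot_between:
  fixes p :: "real poly"
  assumes "p \<noteq> 0" "a < b"
  shows "\<exists>x. a < x \<and> x < b \<and> poly p x \<noteq> 0"
proof -
  have "infinite ({a<..<b} - {x. poly p x = 0})"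
    using assms by (intro Diff_infinite_finite poly_roots_finite) (auto simp: infinite_Ioo)
  then obtain x where "x \<in> {a<..<b} - {x. poly p x = 0}"
    using infinite_imp_nonempty by blast
  then show ?thesis by auto
qed

text \<open>A violated inequality of the chain leaves a gap between two zeros. At a point of this
  gap where neither polynomial vanishes, the counts contradict
  \<open>zeros_above_bounds\<close>.\<close>

lemma interlacesI_upper_half_plane:
  fixes p q :: "real poly"
  assumes p: "real_rooted p" "p \<noteq> 0" "lead_coeff p > 0"
    and q: "real_rooted q" "q \<noteq> 0" "lead_coeff q > 0"
    and pq: "\<And>z. Im z > 0 \<Longrightarrow> Im (cpoly q z * cnj (cpoly p z)) \<ge> 0"
  shows "p \<prec> q"
proof -
  note bounds = zeros_above_bounds[OF p q pq]
  note len = length_zeros[OF p(1,2)] length_zeros[OF q(1,2)]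
  have sep: "\<exists>a. x < a \<and> a < y \<and> poly p a \<noteq> 0 \<and> poly q a \<noteq> 0" if "x < y" for x y
    using ex_nonroot_between[of "p * q", OF _ that] p(2) q(2) by auto
  have above_le: "zeros_above s a \<le> degree s" for s a
    unfolding zeros_above_def
    by (meson le_trans size_filter_mset_lesseq size_proots_le)
  \<comment> \<open>To the left of all zeros the counts are the degrees, so the same bounds yield
    the degree condition.\<close>
  have all_above: "\<exists>m. \<forall>a<m. zeros_above s a = degree s" if "real_rooted s" "s \<noteq> 0" for s
  proof -
    have "finite (set_mset (proots s))" by simp
    then obtain m where m: "\<And>x. x \<in># proots s \<Longrightarrow> m \<le> x"
      by (meson bdd_below.E bdd_below_finite)
    have "zeros_above s a = degree s" if "a < m" for a
    proof -
      have "filter_mset (\<lambda>x. a < x) (proots s) = proots s"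
        using m that by (intro filter_mset_eq_conv[THEN iffD2]) force
      then show ?thesis
        using length_zeros[OF \<open>real_rooted s\<close> \<open>s \<noteq> 0\<close>]
        by (simp add: zeros_above_def zeros_def flip: size_mset)
    qed
    then show ?thesis by blast
  qed
  obtain m1 m2 where m: "\<forall>a<m1. zeros_above p a = degree p" "\<forall>a<m2. zeros_above q a = degree q"
    using all_above p q by metis
  obtain a where "a < min m1 m2" "poly p a \<noteq> 0" "poly q a \<noteq> 0"
    using sep[of "min m1 m2 - 1" "min m1 m2"] by (metis diff_less_eq less_add_one)
  then have deg: "degree q = degree p \<or> degree q = degree p + 1"
    using bounds[of a] m by (auto simp: le_Suc_eq)
  have "zeros p ! i \<le> zeros q ! i" if "i < degree p" for i
  proof (rule ccontr)
    assume "\<not> zeros p ! i \<le> zeros q ! i"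
    then obtain a where a: "zeros q ! i < a" "a < zeros p ! i" "poly p a \<noteq> 0" "poly q a \<noteq> 0"
      using sep by (auto simp: not_le)
    have "i < degree q" using deg that by auto
    then have "i < zeros_above p a" "\<not> i < zeros_above q a"
      using a that by (auto simp: nth_zeros_gt_iff len simp flip: nth_zeros_gt_iff)
    with bounds(1)[of a] a show False by auto
  qed
  moreover have "zeros q ! (i + 1) \<le> zeros p ! i" if "i + 1 < degree q" for i
  proof (rule ccontr)
    assume "\<not> zeros q ! (i + 1) \<le> zeros p ! i"
    then obtain a where a: "zeros p ! i < a" "a < zeros q ! (i + 1)" "poly p a \<noteq> 0" "poly q a \<noteq> 0"
      using sep by (auto simp: not_le)
    have "i < degree p" using deg that by auto
    then have "\<not> i < zeros_above p a" "i + 1 < zeros_above q a"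
      using a that nth_zeros_gt_iff[of i p a] nth_zeros_gt_iff[of "i + 1" q a] by (auto simp: len)
    with bounds(2)[of a] a show False by auto
  qed
  ultimately show ?thesis
    unfolding interlaces_def using p q deg by auto
qed

section \<open>The recursion for the polynomials $r_n$\<close>

lemma lift_fps_nth [simp]: "fps_nth (lift_fps f) n = [:fps_nth f n:]"
  by (simp add: lift_fps_def)

lemma lift_fps_mult: "lift_fps (f * g) = lift_fps f * lift_fps g"
proof (rule fps_ext)
  have sum: "[:sum h A:] = (\<Sum>i\<in>A. [:h i:])" for h :: "nat \<Rightarrow> real" and A
    by (rule poly_eqI) (simp add: coeff_sum coeff_pCons split: nat.split)
  show "fps_nth (lift_fps (f * g)) n = fps_nth (lift_fps f * lift_fps g) n" for n
    by (simp add: fps_mult_nth sum mult.commute)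
qed

lemma lift_fps_simps:
  "lift_fps (f + g) = lift_fps f + lift_fps g"
  "lift_fps (f - g) = lift_fps f - lift_fps g"
  "lift_fps 1 = 1" "lift_fps fps_X = fps_X" "lift_fps (fps_const a) = fps_const [:a:]"
  by (auto intro!: fps_ext simp: fps_X_def)

lemma denom_r_series: "denom f * r_series f = 1"
  by (simp add: r_series_unique)

lemma r_series_0: "fps_nth (r_series f) 0 = 1"
  using arg_cong[OF denom_r_series[of f], of "\<lambda>F. fps_nth F 0"] by (simp add: denom_def)

text \<open>Compare the coefficients of \<open>x^(n+1)\<close> in
  \<open>r_series f * denom f = 1\<close>; \<open>pCons 0\<close> is multiplication by
  \<open>t\<close>.\<close>

lemma r_series_Suc:
  "fps_nth (r_series f) (Suc n)
    = (\<Sum>i\<le>n. pCons 0 (smult (fps_nth f (Suc n - i)) (fps_nth (r_series f) i)))"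
proof -
  let ?r = "fps_nth (r_series f)" and ?d = "fps_nth (denom f)"
  have d: "?d 0 = 1" "\<And>k. k > 0 \<Longrightarrow> ?d k = - [:0, fps_nth f k:]"
    by (simp_all add: denom_def)
  have "0 = fps_nth (r_series f * denom f) (Suc n)"
    by (simp add: mult.commute denom_r_series)
  also have "\<dots> = (\<Sum>i\<le>n. ?r i * ?d (Suc n - i)) + ?r (Suc n)"
    by (simp add: fps_mult_nth d atLeast0AtMost)
  also have "(\<Sum>i\<le>n. ?r i * ?d (Suc n - i))
      = - (\<Sum>i\<le>n. pCons 0 (smult (fps_nth f (Suc n - i)) (?r i)))"
    unfolding sum_negf[symmetric] by (intro sum.cong refl) (simp add: d)
  finally show ?thesis by (simp add: eq_neg_iff_add_eq_0)
qed

text \<open>The bound does not depend on \<open>f\<close>, so along an approximating sequence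
  convergence of the coefficients implies convergence of the polynomials, uniformly on compact
  sets.\<close>

lemma degree_r_series_le: "degree (fps_nth (r_series f) n) \<le> n"
proof (induction n rule: less_induct)
  case (less n)
  show ?case
  proof (cases n)
    case (Suc m)
    show ?thesis
      unfolding Suc r_series_Suc
    proof (rule degree_sum_le)
      fix i assume "i \<in> {..m}"
      then have "degree (fps_nth (r_series f) i) \<le> m"
        using less[of i] Suc by force
      then have "degree (smult (fps_nth f (Suc m - i)) (fps_nth (r_series f) i)) \<le> m"
        using degree_smult_le le_trans by blast
      then show "degree (pCons 0 (smult (fps_nth f (Suc m - i)) (fps_nth (r_series f) i))) \<le> Suc m"
        using degree_pCons_le le_trans Suc_le_mono by blast
    qed simp
  qed (simp add: r_series_0)
qed

lemma coeff_r_series_Suc: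
  "coeff (fps_nth (r_series f) (Suc n)) k = (case k of 0 \<Rightarrow> 0
    | Suc l \<Rightarrow> \<Sum>i\<le>n. fps_nth f (Suc n - i) * coeff (fps_nth (r_series f) i) l)"
  by (simp add: r_series_Suc coeff_sum split: nat.split)

lemma coeff_r_series_nonneg:
  assumes "\<And>k. fps_nth f k \<ge> 0"
  shows "coeff (fps_nth (r_series f) n) k \<ge> 0"
proof (induction n arbitrary: k rule: less_induct)
  case (less n)
  show ?case
  proof (cases n)
    case (Suc m)
    then show ?thesis
      using less assms by (auto simp: coeff_r_series_Suc split: nat.split intro!: sum_nonneg)
  qed (auto simp: r_series_0 coeff_1)
qed

lemma lead_coeff_r_series_pos:
  assumes "\<And>k. fps_nth f k \<ge> 0" "fps_nth (r_series f) n \<noteq> 0"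
  shows "lead_coeff (fps_nth (r_series f) n) > 0"
  using coeff_r_series_nonneg[OF assms(1), of n] assms(2)
  by (metis leading_coeff_0_iff order_le_less)

text \<open>By the recursion each coefficient is a polynomial in finitely many coefficients of
  \<open>f\<close>, hence continuous in them.\<close>

lemma tendsto_coeff_r_series:
  assumes "\<And>k. (\<lambda>N. fps_nth (F N) k) \<longlonglongrightarrow> fps_nth f k"
  shows "(\<lambda>N. coeff (fps_nth (r_series (F N)) n) k) \<longlonglongrightarrow> coeff (fps_nth (r_series f) n) k"
proof (induction n arbitrary: k rule: less_induct)
  case (less n)
  show ?case
  proof (cases n)
    case (Suc m)
    then show ?thesis
      using less assms
      by (auto simp: coeff_r_series_Suc split: nat.split intro!: tendsto_sum tendsto_mult)
  qed (auto simp: r_series_0)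
qed

section \<open>Finite products\<close>

definition linear_quotient :: "real \<Rightarrow> real \<Rightarrow> real fps" where
  "linear_quotient a b = (1 + fps_const a * fps_X) / (1 - fps_const b * fps_X)"

lemma linear_quotient_nth:
  "fps_nth (linear_quotient a b) k = (if k = 0 then 1 else (a + b) * b ^ (k - 1))"
  unfolding linear_quotient_def fps_linear_quotient by simp

lemma linear_quotient_mult: "linear_quotient a b * (1 - fps_const b * fps_X) = 1 + fps_const a * fps_X"
proof -
  have "fps_nth (1 - fps_const b * fps_X) 0 \<noteq> 0" by simp
  then show ?thesis
    unfolding linear_quotient_def
    by (metis (no_types, lifting) fps_divide_unit inverse_mult_eq_1 mult.assoc mult.right_neutral)
qed

locale finite_quotient_product =
  fixes c :: real and \<alpha> \<beta> :: "nat \<Rightarrow> real" and m :: nat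
  assumes c_pos: "c > 0" and \<alpha>_nonneg: "\<And>i. \<alpha> i \<ge> 0" and \<beta>_nonneg: "\<And>i. \<beta> i \<ge> 0"
begin

definition G :: "nat \<Rightarrow> real fps" where
  "G j = (\<Prod>i<j. linear_quotient (\<alpha> i) (\<beta> i))"

definition F :: "real fps" where
  "F = fps_const c * G m"

abbreviation r :: "nat \<Rightarrow> real poly" where
  "r n \<equiv> fps_nth (r_series F) n"

definition w :: "nat \<Rightarrow> nat \<Rightarrow> real poly" where
  "w n j = fps_nth (lift_fps (G j) * r_series F) n"

definition u :: "nat \<Rightarrow> nat \<Rightarrow> real poly" where
  "u n i = smult (\<alpha> i) (w n i) + smult (\<beta> i) (w n (Suc i))"

lemma G_nth_0: "fps_nth (G j) 0 = 1"
  unfolding G_def by (induction j) (auto simp: linear_quotient_nth)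

lemma G_nonneg: "fps_nth (G j) k \<ge> 0"
  unfolding G_def
  by (induction j arbitrary: k)
    (auto simp: fps_mult_nth linear_quotient_nth \<alpha>_nonneg \<beta>_nonneg intro!: sum_nonneg)

lemma F_nonneg: "fps_nth F k \<ge> 0"
  unfolding F_def using c_pos G_nonneg[of m k] by simp

lemma F_nth_0: "fps_nth F 0 = c"
  unfolding F_def by (simp add: G_nth_0)

lemma w_0_left: "w 0 j = 1"
  unfolding w_def by (simp add: G_nth_0 r_series_0)

lemma w_0_right: "w n 0 = r n"
  unfolding w_def by (simp add: G_def lift_fps_simps)

text \<open>Clear the denominator in the quotient of \<open>G (Suc j)\<close> by \<open>G j\<close>,
  multiply by \<open>r_series F\<close> and read off the coefficient of
  \<open>x^(n+1)\<close>.\<close>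

lemma w_Suc_Suc: "w (Suc n) (Suc j) = w (Suc n) j + u n j"
proof -
  let ?W = "\<lambda>j. lift_fps (G j) * r_series F"
  have "G (Suc j) * (1 - fps_const (\<beta> j) * fps_X) = G j * (1 + fps_const (\<alpha> j) * fps_X)"
    unfolding G_def by (simp add: linear_quotient_mult mult.assoc)
  then have "lift_fps (G (Suc j)) * (1 - fps_const [:\<beta> j:] * fps_X)
      = lift_fps (G j) * (1 + fps_const [:\<alpha> j:] * fps_X)"
    by (metis lift_fps_mult lift_fps_simps)
  then have "lift_fps (G (Suc j)) * (1 - fps_const [:\<beta> j:] * fps_X) * r_series F
      = lift_fps (G j) * (1 + fps_const [:\<alpha> j:] * fps_X) * r_series F"
    by (rule arg_cong)
  then have "?W (Suc j) = ?W j + fps_X * (fps_const [:\<alpha> j:] * ?W j + fps_const [:\<beta> j:] * ?W (Suc j))"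
    by (simp add: algebra_simps)
  then have "fps_nth (?W (Suc j)) (Suc n) = fps_nth (?W j
      + fps_X * (fps_const [:\<alpha> j:] * ?W j + fps_const [:\<beta> j:] * ?W (Suc j))) (Suc n)"
    by (rule arg_cong)
  then show ?thesis
    unfolding w_def u_def by (simp add: fps_X_mult_nth)
qed

lemma w_Suc: "w (Suc n) j = r (Suc n) + (\<Sum>i<j. u n i)"
  by (induction j) (simp_all add: w_0_right w_Suc_Suc)

text \<open>The denominator equals \<open>(1 + c t) - c t G m\<close>. Comparing coefficients at a
  positive power of \<open>x\<close>, where the right-hand side 1 vanishes, ties the last index
  \<open>m\<close> back to the index 0.\<close>

lemma seam: "[:1, c:] * r (Suc n) = [:0, c:] * w (Suc n) m"
proof -
  let ?W = "lift_fps (G m) * r_series F"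
  have "denom F = fps_const [:1, c:] - fps_const [:0, c:] * lift_fps (G m)"
    unfolding denom_def F_nth_0 by (rule fps_ext) (simp add: F_def algebra_simps one_pCons)
  then have "(fps_const [:1, c:] - fps_const [:0, c:] * lift_fps (G m)) * r_series F = 1"
    using denom_r_series[of F] by simp
  then have "fps_const [:1, c:] * r_series F = fps_const [:0, c:] * ?W + 1"
    by (simp add: algebra_simps)
  then have "fps_nth (fps_const [:1, c:] * r_series F) (Suc n)
      = fps_nth (fps_const [:0, c:] * ?W + 1) (Suc n)"
    by (rule arg_cong)
  then show ?thesis
    unfolding w_def by simp
qed

text \<open>Substituting \<open>w_Suc\<close> at \<open>j = m\<close> into \<open>seam\<close>
  cancels \<open>c t\<close> times \<open>r (Suc n)\<close> and leaves the factor 1 on the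
  left.\<close>

lemma r_Suc: "r (Suc n) = [:0, c:] * (\<Sum>i<m. u n i)"
proof -
  have "[:1, c:] * r (Suc n) - [:0, c:] * r (Suc n) = [:0, c:] * (\<Sum>i<m. u n i)"
    unfolding seam w_Suc by (simp add: algebra_simps)
  then show ?thesis by simp
qed

text \<open>Every \<open>u n i\<close> enters through \<open>r (Suc n)\<close> with factor
  \<open>c t\<close>; those with \<open>i < j\<close> enter once more through \<open>w_Suc\<close>.
  All coefficients are thus multiples of \<open>1 + c t\<close> or \<open>c t\<close>.\<close>

lemma w_Suc_split:
  assumes "j \<le> m"
  shows "w (Suc n) j = [:1, c:] * (\<Sum>i<j. u n i) + [:0, c:] * (\<Sum>i=j..<m. u n i)"
proof -
  have "(\<Sum>i<m. u n i) = (\<Sum>i<j. u n i) + (\<Sum>i=j..<m. u n i)"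
    using assms by (metis atLeast0LessThan le0 sum.atLeastLessThan_concat)
  then show ?thesis
    unfolding w_Suc r_Suc by (simp add: algebra_simps)
qed

end

section \<open>Sums of complex numbers in a sector\<close>

lemma Im_sum_mult_cnj_sum:
  "Im (k * (\<Sum>i\<in>A. x i) * cnj (\<Sum>j\<in>B. y j)) = (\<Sum>i\<in>A. \<Sum>j\<in>B. Im (k * x i * cnj (y j)))"
  by (simp only: cnj_sum sum_distrib_left[of k] sum_product Im_sum)

lemma Im_sum_mult_cnj_sum_nonneg:
  assumes "\<And>i j. i \<in> A \<Longrightarrow> j \<in> B \<Longrightarrow> Im (k * x i * cnj (y j)) \<ge> 0"
  shows "Im (k * (\<Sum>i\<in>A. x i) * cnj (\<Sum>j\<in>B. y j)) \<ge> 0"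
  unfolding Im_sum_mult_cnj_sum using assms by (intro sum_nonneg)

text \<open>Numbers in such a sector cannot cancel: for \<open>y = - x\<close> the second assumption
  says that \<open>- Im k * (cmod x)\<^sup>2\<close> is nonnegative.\<close>

lemma add_eq_0_cone:
  assumes "Im k > 0" "Im (k * y * cnj x) \<ge> 0" "x + y = 0"
  shows "x = 0" "y = 0"
proof -
  have "y = - x" using assms(3) by (simp add: eq_neg_iff_add_eq_0 add.commute)
  then have "Im (k * y * cnj x) = - Im (k * (x * cnj x))" by (simp add: mult.assoc)
  also have "\<dots> = - (Im k * (cmod x)\<^sup>2)"
    unfolding complex_norm_square[symmetric] by simp
  finally have "Im k * (cmod x)\<^sup>2 \<le> 0" using assms(2) by simp
  then show "x = 0" using assms(1) by (simp add: mult_le_0_iff)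
  then show "y = 0" using assms(3) by simp
qed

text \<open>The pairwise condition is additive in \<open>x i\<close>, so it holds between the last
  term and the sum of the others, and \<open>add_eq_0_cone\<close> splits off the last term.\<close>

lemma sum_eq_0_cone:
  fixes x :: "nat \<Rightarrow> complex"
  assumes "Im k > 0" "\<And>i j. i < j \<Longrightarrow> j < m \<Longrightarrow> Im (k * x j * cnj (x i)) \<ge> 0" "(\<Sum>i<m. x i) = 0"
  shows "\<forall>i<m. x i = 0"
  using assms(2,3)
proof (induction m)
  case (Suc m)
  have "Im (k * (\<Sum>j\<in>{m}. x j) * cnj (\<Sum>i<m. x i)) \<ge> 0"
    using Suc.prems(1) by (intro Im_sum_mult_cnj_sum_nonneg) auto
  then have "Im (k * x m * cnj (\<Sum>i<m. x i)) \<ge> 0" by simp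
  moreover have "(\<Sum>i<m. x i) + x m = 0" using Suc.prems(2) by simp
  ultimately have "(\<Sum>i<m. x i) = 0" "x m = 0"
    using add_eq_0_cone[OF assms(1)] by blast+
  moreover from this(1) have "\<forall>i<m. x i = 0"
    using Suc.IH Suc.prems(1) less_SucI by blast
  ultimately show ?case by (metis less_Suc_eq)
qed auto

lemma Im_of_real_mult: "Im (of_real a * x) = a * Im x"
  by simp

lemma Im_mult_cnj_self: "Im (k * x * cnj x) = Im k * (cmod x)\<^sup>2"
  unfolding mult.assoc complex_norm_square[symmetric] by simp

text \<open>For nonzero \<open>L\<close> the number \<open>K * cnj L\<close> is a positive multiple
  of \<open>K / L\<close>. Both claims follow from identities that write the left-hand sides as
  combinations, with nonnegative real coefficients, of the quantities in the assumptions and a real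
  number; the mixed terms of \<open>A\<close> and \<open>D\<close> are absorbed in the squared
  modulus of \<open>?P\<close>.\<close>

lemma mixture_cone:
  fixes K L A B D :: complex
  defines "x \<equiv> L * A + K * (B + D)" and "y \<equiv> L * (A + B) + K * D"
  assumes "Im (K * cnj L) \<ge> 0"
    and "Im (A * cnj B) \<ge> 0" "Im (B * cnj D) \<ge> 0"
    and "Im (K * cnj L * B * cnj A) \<ge> 0" "Im (K * cnj L * D * cnj B) \<ge> 0"
  shows "Im (x * cnj y) \<ge> 0" "Im (K * cnj L * y * cnj x) \<ge> 0"
proof -
  let ?P = "L * A + K * D" and ?n = "\<lambda>x. complex_of_real ((cmod x)\<^sup>2)"
  have "x * cnj y = ?n ?P + ?n L * (A * cnj B) + K * cnj L * D * cnj B + K * cnj L * B * cnj A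
      + ?n K * (B * cnj D) + ?n B * (K * cnj L)"
    unfolding complex_norm_square x_def y_def complex_cnj_add complex_cnj_mult complex_cnj_cnj
    by algebra
  then have "Im (x * cnj y) = (cmod L)\<^sup>2 * Im (A * cnj B) + Im (K * cnj L * D * cnj B)
      + Im (K * cnj L * B * cnj A) + (cmod K)\<^sup>2 * Im (B * cnj D) + (cmod B)\<^sup>2 * Im (K * cnj L)"
    by (simp only: plus_complex.sel Im_of_real_mult Im_complex_of_real add_0_left)
  then show "Im (x * cnj y) \<ge> 0"
    using assms by (simp del: times_complex.sel complex_cnj)
  have "K * cnj L * y * cnj x = ?n ?P * (K * cnj L) + ?n K * ?n L * (A * cnj B)
      + ?n K * (K * cnj L * D * cnj B) + ?n L * (K * cnj L * B * cnj A)
      + ?n L * ?n K * (B * cnj D) + ?n B * ?n K * ?n L"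
    unfolding complex_norm_square x_def y_def complex_cnj_add complex_cnj_mult complex_cnj_cnj
    by algebra
  then have "Im (K * cnj L * y * cnj x) = (cmod ?P)\<^sup>2 * Im (K * cnj L)
      + ((cmod K)\<^sup>2 * (cmod L)\<^sup>2) * Im (A * cnj B)
      + (cmod K)\<^sup>2 * Im (K * cnj L * D * cnj B) + (cmod L)\<^sup>2 * Im (K * cnj L * B * cnj A)
      + ((cmod L)\<^sup>2 * (cmod K)\<^sup>2) * Im (B * cnj D)"
    by (simp only: plus_complex.sel Im_of_real_mult Im_complex_of_real add_0_right flip: of_real_mult)
  then show "Im (K * cnj L * y * cnj x) \<ge> 0"
    using assms by (simp del: times_complex.sel complex_cnj)
qed

text \<open>Multiply \<open>L * A = - K * D\<close> by \<open>cnj L * cnj D\<close>. The imaginary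
  parts of the two sides have opposite signs, which forces \<open>D = 0\<close> and then
  \<open>A = 0\<close>.\<close>

lemma mixture_neq_0:
  assumes q: "Im (K * cnj L) > 0" and "Im (A * cnj D) \<ge> 0" "L * A + K * D = 0"
  shows "A + D = 0"
proof -
  have "L \<noteq> 0" using q by auto
  have "of_real ((cmod L)\<^sup>2) * (A * cnj D) = (L * A) * cnj L * cnj D"
    unfolding complex_norm_square by simp
  also have "\<dots> = - (K * cnj L * D * cnj D)"
    using assms(3) by (simp add: eq_neg_iff_add_eq_0[symmetric])
  finally have "(cmod L)\<^sup>2 * Im (A * cnj D) = - (Im (K * cnj L) * (cmod D)\<^sup>2)"
    by (metis Im_mult_cnj_self Im_of_real_mult uminus_complex.sel(2))
  moreover have "(cmod L)\<^sup>2 * Im (A * cnj D) \<ge> 0"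
    by (rule mult_nonneg_nonneg[OF zero_le_power2 assms(2)])
  ultimately have "Im (K * cnj L) * (cmod D)\<^sup>2 \<le> 0" by simp
  then have "D = 0" using q by (simp add: mult_le_0_iff del: times_complex.sel)
  then show ?thesis using assms(3) \<open>L \<noteq> 0\<close> by simp
qed

section \<open>Location of the values and zeros for finite products\<close>

context finite_quotient_product
begin

text \<open>At a point \<open>z\<close> of the upper half-plane the values of \<open>w n 0, \<dots>, w n m\<close> are in order of
  decreasing argument, within a sector whose angle is the argument of \<open>c z / (1 + c z)\<close>.\<close>

definition sector :: "complex \<Rightarrow> nat \<Rightarrow> bool" where
  "sector z n \<longleftrightarrow> (\<forall>i j. i \<le> j \<longrightarrow> j \<le> m \<longrightarrow>
     Im (cpoly (w n i) z * cnj (cpoly (w n j) z)) \<ge> 0 \<and>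
     Im (of_real c * z * cnj (1 + of_real c * z) * cpoly (w n j) z * cnj (cpoly (w n i) z)) \<ge> 0)"

lemma cpoly_u: "cpoly (u n i) z = of_real (\<alpha> i) * cpoly (w n i) z + of_real (\<beta> i) * cpoly (w n (Suc i)) z"
  by (simp add: u_def)

text \<open>\<open>u n i\<close> combines the values at \<open>i\<close> and \<open>Suc i\<close>
  with nonnegative weights. For \<open>i < j\<close> also \<open>Suc i \<le> j\<close>, so all four
  pairs are in order; for \<open>i = j\<close> one pair is not, but the product is then a squared
  modulus.\<close>

lemma sector_u:
  assumes z: "Im z > 0" and n: "sector z n" and ij: "i \<le> j" "j < m"
  shows "Im (cpoly (u n i) z * cnj (cpoly (u n j) z)) \<ge> 0"
    and "Im (of_real c * z * cnj (1 + of_real c * z) * cpoly (u n j) z * cnj (cpoly (u n i) z)) \<ge> 0"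
proof -
  let ?q = "of_real c * z * cnj (1 + of_real c * z)"
  let ?v = "\<lambda>i. cpoly (w n i) z" and ?y = "\<lambda>i. cpoly (u n i) z"
  have q: "Im ?q > 0" using z c_pos by (simp add: algebra_simps)
  \<comment> \<open>The factor \<open>k\<close> allows one expansion to serve both inequalities,
    with \<open>k = 1\<close> and with \<open>k = ?q\<close> and the indices exchanged.\<close>
  have bil: "Im (k * ?y i * cnj (?y j)) =
      \<alpha> i * \<alpha> j * Im (k * ?v i * cnj (?v j)) + \<alpha> i * \<beta> j * Im (k * ?v i * cnj (?v (Suc j)))
      + \<beta> i * \<alpha> j * Im (k * ?v (Suc i) * cnj (?v j))
      + \<beta> i * \<beta> j * Im (k * ?v (Suc i) * cnj (?v (Suc j)))" for k i j
    unfolding cpoly_u by (simp add: algebra_simps)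
  have v: "Im (1 * ?v i * cnj (?v j)) \<ge> 0" "Im (?q * ?v j * cnj (?v i)) \<ge> 0"
    if "i \<le> j" "j \<le> m" for i j
    using n that unfolding sector_def mult_1 by blast+
  have "Im (1 * ?y i * cnj (?y j)) \<ge> 0 \<and> Im (?q * ?y j * cnj (?y i)) \<ge> 0"
  proof (cases "i = j")
    case True
    then show ?thesis
      using q unfolding True Im_mult_cnj_self by (simp del: times_complex.sel)
  next
    case False
    then show ?thesis
      unfolding bil using ij
      by (intro conjI add_nonneg_nonneg mult_nonneg_nonneg \<alpha>_nonneg \<beta>_nonneg v) auto
  qed
  then show "Im (?y i * cnj (?y j)) \<ge> 0" "Im (?q * ?y j * cnj (?y i)) \<ge> 0"
    unfolding mult_1 by blast+
qed

lemma cpoly_w_Suc: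
  assumes "j \<le> m"
  shows "cpoly (w (Suc n) j) z = (1 + of_real c * z) * (\<Sum>i<j. cpoly (u n i) z)
     + of_real c * z * (\<Sum>i=j..<m. cpoly (u n i) z)"
proof -
  have "cpoly [:1, c:] z = 1 + of_real c * z" "cpoly [:0, c:] z = of_real c * z"
    by (simp_all add: map_poly_pCons)
  then show ?thesis
    unfolding w_Suc_split[OF assms] cpoly_simps cpoly_sum by metis
qed

lemma sector:
  assumes z: "Im z > 0"
  shows "sector z n"
proof (induction n)
  case 0
  show ?case
    using z c_pos unfolding sector_def w_0_left by (simp add: algebra_simps)
next
  case (Suc n)
  let ?K = "of_real c * z" and ?L = "1 + of_real c * z"
  let ?y = "\<lambda>i. cpoly (u n i) z"
  have q: "Im (?K * cnj ?L) > 0" using z c_pos by (simp add: algebra_simps)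
  note y = sector_u[OF z Suc]
  show ?case
    unfolding sector_def
  proof (intro allI impI)
    fix i j assume ij: "i \<le> j" "j \<le> m"
    \<comment> \<open>Between \<open>w (Suc n) i\<close> and \<open>w (Suc n) j\<close> only the
      middle block \<open>B\<close> changes its factor, from \<open>?K\<close> to \<open>?L\<close>;
      this is the situation of \<open>mixture_cone\<close>.\<close>
    define A B D where "A = (\<Sum>l<i. ?y l)" and "B = (\<Sum>l=i..<j. ?y l)" and "D = (\<Sum>l=j..<m. ?y l)"
    have AB: "(\<Sum>l<j. ?y l) = A + B"
      unfolding A_def B_def using ij by (metis atLeast0LessThan le0 sum.atLeastLessThan_concat)
    have BD: "(\<Sum>l=i..<m. ?y l) = B + D"
      unfolding B_def D_def using ij by (simp add: sum.atLeastLessThan_concat)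
    have wi: "cpoly (w (Suc n) i) z = ?L * A + ?K * (B + D)"
      using cpoly_w_Suc[of i n z] ij BD by (simp add: A_def)
    have wj: "cpoly (w (Suc n) j) z = ?L * (A + B) + ?K * D"
      using cpoly_w_Suc[of j n z] ij AB by (simp add: D_def)
    have "Im (1 * A * cnj B) \<ge> 0" "Im (1 * B * cnj D) \<ge> 0"
      "Im (?K * cnj ?L * B * cnj A) \<ge> 0" "Im (?K * cnj ?L * D * cnj B) \<ge> 0"
      unfolding A_def B_def D_def using ij
      by (intro Im_sum_mult_cnj_sum_nonneg; use y in \<open>auto simp del: times_complex.sel\<close>)+
    then show "Im (cpoly (w (Suc n) i) z * cnj (cpoly (w (Suc n) j) z)) \<ge> 0 \<and>
       Im (?K * cnj ?L * cpoly (w (Suc n) j) z * cnj (cpoly (w (Suc n) i) z)) \<ge> 0"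
      unfolding wi wj mult_1 using q by (intro conjI mixture_cone) linarith+
  qed
qed

text \<open>A zero at level \<open>Suc n\<close> forces the sum of all \<open>u n i\<close> to
  vanish, then each \<open>u n i\<close>, then both summands of \<open>u n i0\<close>, each time
  because numbers in the sector do not cancel. One weight at \<open>i0\<close> is positive, so some
  \<open>w n\<close> vanishes, against the induction hypothesis. The index \<open>i0\<close>
  excludes constant \<open>F\<close>.\<close>

lemma cpoly_w_nonzero:
  assumes z: "Im z > 0" and i0: "i0 < m" "\<alpha> i0 + \<beta> i0 > 0" and "j \<le> m"
  shows "cpoly (w n j) z \<noteq> 0"
  using \<open>j \<le> m\<close>
proof (induction n arbitrary: j)
  case 0
  then show ?case by (simp add: w_0_left)
next
  case (Suc n)
  let ?K = "of_real c * z" and ?L = "1 + of_real c * z"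
  let ?y = "\<lambda>i. cpoly (u n i) z" and ?v = "\<lambda>i. cpoly (w n i) z"
  have q: "Im (?K * cnj ?L) > 0" using z c_pos by (simp add: algebra_simps)
  note y = sector_u[OF z sector[OF z]]
  have sum: "(\<Sum>i<j. ?y i) + (\<Sum>i=j..<m. ?y i) = (\<Sum>i<m. ?y i)"
    using Suc.prems by (metis atLeast0LessThan le0 sum.atLeastLessThan_concat)
  show ?case
  proof
    assume "cpoly (w (Suc n) j) z = 0"
    then have "?L * (\<Sum>i<j. ?y i) + ?K * (\<Sum>i=j..<m. ?y i) = 0"
      using cpoly_w_Suc[OF Suc.prems] by simp
    moreover have "Im (1 * (\<Sum>i<j. ?y i) * cnj (\<Sum>i=j..<m. ?y i)) \<ge> 0"
      using y by (intro Im_sum_mult_cnj_sum_nonneg) (auto simp del: times_complex.sel)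
    ultimately have "(\<Sum>i<m. ?y i) = 0"
      using mixture_neq_0[OF q] sum unfolding mult_1 by metis
    then have "\<forall>i<m. ?y i = 0"
      using y(2) less_imp_le by (intro sum_eq_0_cone[OF q]) blast+
    then have "of_real (\<alpha> i0) * ?v i0 + of_real (\<beta> i0) * ?v (Suc i0) = 0"
      using i0(1) unfolding cpoly_u by blast
    moreover have "Im (?K * cnj ?L * (of_real (\<beta> i0) * ?v (Suc i0)) * cnj (of_real (\<alpha> i0) * ?v i0)) \<ge> 0"
    proof -
      have "Im (?K * cnj ?L * ?v (Suc i0) * cnj (?v i0)) \<ge> 0"
        using sector[OF z, of n] i0(1) unfolding sector_def by (meson Suc_leI le_SucI order_refl)
      then have "\<beta> i0 * \<alpha> i0 * Im (?K * cnj ?L * ?v (Suc i0) * cnj (?v i0)) \<ge> 0"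
        by (intro mult_nonneg_nonneg \<alpha>_nonneg \<beta>_nonneg)
      also have "\<beta> i0 * \<alpha> i0 * Im (?K * cnj ?L * ?v (Suc i0) * cnj (?v i0))
          = Im (of_real (\<beta> i0 * \<alpha> i0) * (?K * cnj ?L * ?v (Suc i0) * cnj (?v i0)))"
        by (simp only: Im_of_real_mult)
      finally show ?thesis by (simp add: mult_ac del: times_complex.sel)
    qed
    ultimately have "of_real (\<alpha> i0) * ?v i0 = 0" "of_real (\<beta> i0) * ?v (Suc i0) = 0"
      using add_eq_0_cone[OF q] by blast+
    then show False
      using Suc.IH[of i0] Suc.IH[of "Suc i0"] i0 by (cases "\<alpha> i0 = 0") auto
  qed
qed

text \<open>To the left of \<open>- 1 / c\<close> both factors \<open>1 + c x\<close> and
  \<open>c x\<close> are negative, so each step of the recursion reverses the common sign of all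
  \<open>w n j\<close>.\<close>

lemma poly_w_sign:
  assumes x: "x < - 1 / c" and i0: "i0 < m" "\<alpha> i0 + \<beta> i0 > 0" and "j \<le> m"
  shows "(- 1) ^ n * poly (w n j) x > 0"
  using \<open>j \<le> m\<close>
proof (induction n arbitrary: j)
  case 0
  then show ?case by (simp add: w_0_left)
next
  case (Suc n)
  define s where "s i = (- 1) ^ n * poly (w n i) x" for i
  define y where "y i = (- 1) ^ n * poly (u n i) x" for i
  have s: "s i > 0" if "i \<le> m" for i
    using Suc.IH that unfolding s_def .
  have cx: "c * x < - 1" using x c_pos by (simp add: field_simps)
  have y_eq: "y i = \<alpha> i * s i + \<beta> i * s (Suc i)" for i
    by (simp add: y_def s_def u_def algebra_simps)
  have y: "y i \<ge> 0" if "i < m" for i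
    unfolding y_eq using s[of i] s[of "Suc i"] that \<alpha>_nonneg \<beta>_nonneg
    by (intro add_nonneg_nonneg mult_nonneg_nonneg) auto
  have "y i0 > 0"
  proof (cases "\<alpha> i0 > 0")
    case True
    then show ?thesis unfolding y_eq using s[of i0] s[of "Suc i0"] i0 \<beta>_nonneg[of i0]
      by (intro add_pos_nonneg mult_pos_pos mult_nonneg_nonneg) auto
  next
    case False
    then show ?thesis unfolding y_eq using s[of i0] s[of "Suc i0"] i0 \<alpha>_nonneg[of i0]
      by (intro add_nonneg_pos mult_pos_pos mult_nonneg_nonneg) auto
  qed
  then have "(\<Sum>i<m. y i) > 0"
    using i0(1) y by (intro sum_pos2[of _ i0]) auto
  moreover have "(\<Sum>i<j. y i) + (\<Sum>i=j..<m. y i) = (\<Sum>i<m. y i)"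
    using Suc.prems by (metis atLeast0LessThan le0 sum.atLeastLessThan_concat)
  moreover have A: "(\<Sum>i<j. y i) \<ge> 0" and D: "(\<Sum>i=j..<m. y i) \<ge> 0"
    using y Suc.prems by (auto intro!: sum_nonneg)
  ultimately have "- (1 + c * x) * (\<Sum>i<j. y i) + - (c * x) * (\<Sum>i=j..<m. y i) > 0"
  proof (cases "(\<Sum>i<j. y i) > 0")
    case True
    then show ?thesis using cx D by (intro add_pos_nonneg mult_pos_pos mult_nonneg_nonneg) auto
  next
    case False
    with \<open>(\<Sum>i<m. y i) > 0\<close> A have "(\<Sum>i=j..<m. y i) > 0" "(\<Sum>i<j. y i) = 0"
      using \<open>(\<Sum>i<j. y i) + (\<Sum>i=j..<m. y i) = (\<Sum>i<m. y i)\<close> by auto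
    then show ?thesis using cx by (simp add: mult_neg_pos)
  qed
  then show ?case
    unfolding w_Suc_split[OF Suc.prems] y_def
    by (simp add: algebra_simps poly_sum sum_negf flip: sum_distrib_left)
qed

lemma r_Suc_eq_0:
  assumes "\<not> (\<exists>i<m. \<alpha> i + \<beta> i > 0)"
  shows "r (Suc n) = 0"
proof -
  have "\<alpha> i = 0 \<and> \<beta> i = 0" if "i < m" for i
    using assms that \<alpha>_nonneg[of i] \<beta>_nonneg[of i] by (metis add_nonneg_eq_0_iff add_nonneg_nonneg order_le_less)
  then show ?thesis by (simp add: r_Suc u_def)
qed

lemma r_nonzero_upper: "r n = 0 \<or> (\<forall>z. Im z > 0 \<longrightarrow> cpoly (r n) z \<noteq> 0)"
proof (cases "\<exists>i<m. \<alpha> i + \<beta> i > 0")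
  case True
  then show ?thesis using cpoly_w_nonzero[of _ _ 0 n] unfolding w_0_right by blast
next
  case False
  then show ?thesis by (cases n) (auto simp: r_Suc_eq_0 r_series_0)
qed

text \<open>Stated on an open half-plane rather than on the real ray, so that Hurwitz's theorem
  applies; nonreal points are covered by the upper half-plane and conjugation.\<close>

lemma r_nonzero_left: "r n = 0 \<or> (\<forall>z. Re z < - 1 / c \<longrightarrow> cpoly (r n) z \<noteq> 0)"
proof (cases "\<exists>i<m. \<alpha> i + \<beta> i > 0")
  case True
  have "cpoly (r n) z \<noteq> 0" if z: "Re z < - 1 / c" for z
  proof (cases "Im z = 0")
    case im: True
    then have "z = of_real (Re z)" by (simp add: complex_eq_iff)
    moreover have "poly (r n) (Re z) \<noteq> 0"
      using poly_w_sign[OF z, of _ 0 n] True unfolding w_0_right by force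
    ultimately show ?thesis by (metis cpoly_of_real of_real_eq_0_iff)
  next
    case False
    then show ?thesis
      using r_nonzero_upper[of n] True cpoly_w_nonzero[of "z" _ 0 n] cpoly_w_nonzero[of "cnj z" _ 0 n]
      unfolding w_0_right cpoly_cnj by (cases "Im z > 0") auto
  qed
  then show ?thesis by blast
next
  case False
  then show ?thesis by (cases n) (auto simp: r_Suc_eq_0 r_series_0)
qed

text \<open>\<open>r (Suc n)\<close> is \<open>?K\<close> times a nonnegative combination of the
  values \<open>?v i\<close>. Since \<open>?K = ?K * cnj (1 + ?K) - (cmod ?K)\<^sup>2\<close>, the
  imaginary part of \<open>?K * ?v i * cnj (?v 0)\<close> is a nonnegative combination of the two
  quantities in \<open>sector\<close>.\<close>

lemma r_consecutive:
  assumes z: "Im z > 0"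
  shows "Im (cpoly (r (Suc n)) z * cnj (cpoly (r n) z)) \<ge> 0"
proof -
  let ?K = "of_real c * z" and ?v = "\<lambda>i. cpoly (w n i) z"
  have v: "Im (?K * ?v i * cnj (?v 0)) \<ge> 0" if "i \<le> m" for i
  proof -
    have K: "?K * ?v i * cnj (?v 0) = ?K * cnj (1 + ?K) * ?v i * cnj (?v 0)
        - of_real ((cmod ?K)\<^sup>2) * (?v i * cnj (?v 0))"
      unfolding complex_norm_square by (simp add: algebra_simps)
    have "Im (?v i * cnj (?v 0)) = - Im (?v 0 * cnj (?v i))"
      by simp
    then have "Im (?K * ?v i * cnj (?v 0)) = Im (?K * cnj (1 + ?K) * ?v i * cnj (?v 0))
        + (cmod ?K)\<^sup>2 * Im (?v 0 * cnj (?v i))"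
      unfolding K minus_complex.sel Im_of_real_mult by (simp del: times_complex.sel)
    also have "\<dots> \<ge> 0"
      using sector[OF z, of n] that unfolding sector_def
      by (intro add_nonneg_nonneg mult_nonneg_nonneg zero_le_power2) blast+
    finally show ?thesis .
  qed
  have "Im (?K * cpoly (u n i) z * cnj (?v 0)) \<ge> 0" if "i < m" for i
  proof -
    have "Im (?K * cpoly (u n i) z * cnj (?v 0))
        = \<alpha> i * Im (?K * ?v i * cnj (?v 0)) + \<beta> i * Im (?K * ?v (Suc i) * cnj (?v 0))"
      unfolding cpoly_u by (simp add: algebra_simps)
    also have "\<dots> \<ge> 0"
      using that by (intro add_nonneg_nonneg mult_nonneg_nonneg \<alpha>_nonneg \<beta>_nonneg v) auto
    finally show ?thesis .
  qed
  \<comment> \<open>The singleton sum gives the second factor the shape required by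
    \<open>Im_sum_mult_cnj_sum_nonneg\<close>.\<close>
  then have "Im (?K * (\<Sum>i<m. cpoly (u n i) z) * cnj (\<Sum>j\<in>{0::nat}. ?v 0)) \<ge> 0"
    by (intro Im_sum_mult_cnj_sum_nonneg) auto
  moreover have "cpoly (r (Suc n)) z = ?K * (\<Sum>i<m. cpoly (u n i) z)"
    using cpoly_w_Suc[of 0 n z] by (simp add: w_0_right atLeast0LessThan)
  ultimately show ?thesis by (simp add: w_0_right)
qed

end

section \<open>Passage to the limit\<close>

lemma tendsto_cpoly:
  assumes "\<And>N. degree (P N) \<le> n" "degree p \<le> n" "\<And>k. (\<lambda>N. coeff (P N) k) \<longlonglongrightarrow> coeff p k"
  shows "(\<lambda>N. cpoly (P N) z) \<longlonglongrightarrow> cpoly p z"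
  unfolding cpoly_altdef[OF assms(1)] cpoly_altdef[OF assms(2)]
  by (intro tendsto_intros assms(3))

lemma uniform_limit_cpoly:
  assumes deg: "\<And>N. degree (P N) \<le> n" "degree p \<le> n"
    and lim: "\<And>k. (\<lambda>N. coeff (P N) k) \<longlonglongrightarrow> coeff p k" and "compact K"
  shows "uniform_limit K (\<lambda>N. cpoly (P N)) (cpoly p) sequentially"
proof -
  obtain B where B: "\<And>z. z \<in> K \<Longrightarrow> norm z \<le> B"
    using compact_imp_bounded[OF \<open>compact K\<close>] by (auto simp: bounded_iff)
  define \<epsilon> where "\<epsilon> N = (\<Sum>k\<le>n. \<bar>coeff (P N) k - coeff p k\<bar> * B ^ k)" for N
  have "\<epsilon> \<longlonglongrightarrow> (\<Sum>k\<le>n. \<bar>coeff p k - coeff p k\<bar> * B ^ k)"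
    unfolding \<epsilon>_def by (intro tendsto_intros lim)
  then have \<epsilon>: "\<epsilon> \<longlonglongrightarrow> 0" by simp
  have le: "dist (cpoly (P N) z) (cpoly p z) \<le> \<epsilon> N" if "z \<in> K" for N z
  proof -
    have "cpoly (P N) z - cpoly p z = (\<Sum>k\<le>n. of_real (coeff (P N) k - coeff p k) * z ^ k)"
      unfolding cpoly_altdef[OF deg(1)] cpoly_altdef[OF deg(2)]
      by (simp add: sum_subtractf algebra_simps)
    also have "norm \<dots> \<le> (\<Sum>k\<le>n. norm (of_real (coeff (P N) k - coeff p k) * z ^ k))"
      by (rule norm_sum)
    also have "\<dots> \<le> \<epsilon> N"
      unfolding \<epsilon>_def norm_mult norm_power norm_of_real
      by (intro sum_mono mult_left_mono power_mono B that) auto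
    finally show ?thesis by (simp add: dist_norm)
  qed
  show ?thesis
  proof (rule uniform_limitI)
    fix e :: real assume "e > 0"
    with \<epsilon> have "eventually (\<lambda>N. \<epsilon> N < e) sequentially"
      by (rule order_tendstoD)
    then show "eventually (\<lambda>N. \<forall>z\<in>K. dist (cpoly (P N) z) (cpoly p z) < e) sequentially"
      by eventually_elim (use le in \<open>auto intro: le_less_trans\<close>)
  qed
qed

text \<open>Hurwitz's theorem requires a nonconstant limit; a constant limit with a zero would
  vanish on the whole infinite set \<open>S\<close>.\<close>

lemma limit_nonzero:
  assumes deg: "\<And>N. degree (P N) \<le> n" "degree p \<le> n"
    and lim: "\<And>k. (\<lambda>N. coeff (P N) k) \<longlonglongrightarrow> coeff p k"
    and S: "open S" "connected S"
    and P: "\<And>N. P N = 0 \<or> (\<forall>z\<in>S. cpoly (P N) z \<noteq> 0)"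
    and "p \<noteq> 0" "z0 \<in> S"
  shows "cpoly p z0 \<noteq> 0"
proof (cases "cpoly p constant_on S")
  case True
  show ?thesis
  proof
    assume "cpoly p z0 = 0"
    with True \<open>z0 \<in> S\<close> have "S \<subseteq> {z. cpoly p z = 0}"
      by (auto simp: constant_on_def)
    moreover have "finite {z. cpoly p z = 0}"
      using \<open>p \<noteq> 0\<close> by (intro poly_roots_finite) (simp add: map_poly_eq_0_iff)
    ultimately have "finite S" by (rule finite_subset)
    with S(1) \<open>z0 \<in> S\<close> show False
      using finite_imp_not_open by blast
  qed
next
  case False
  \<comment> \<open>The leading coefficient of the limit rules out \<open>P N = 0\<close> for large
    \<open>N\<close>, so Hurwitz's theorem is applied to the sequence shifted by
    \<open>N0\<close>.\<close>
  have "coeff p (degree p) \<noteq> 0" using \<open>p \<noteq> 0\<close> by simp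
  then have "eventually (\<lambda>N. coeff (P N) (degree p) \<noteq> 0) sequentially"
    by (rule tendsto_imp_eventually_ne[OF lim])
  then obtain N0 where "\<And>N. N \<ge> N0 \<Longrightarrow> coeff (P N) (degree p) \<noteq> 0"
    by (auto simp: eventually_sequentially)
  then have nz: "P (N + N0) \<noteq> 0" for N
    by (metis coeff_0 le_add2)
  show ?thesis
  proof (rule Hurwitz_no_zeros[OF S _ _ _ False _ \<open>z0 \<in> S\<close>, of "\<lambda>N. cpoly (P (N + N0))"])
    show "uniform_limit K (\<lambda>N. cpoly (P (N + N0))) (cpoly p) sequentially" if "compact K" for K
      using deg that by (intro uniform_limit_cpoly LIMSEQ_ignore_initial_segment lim)
    show "cpoly (P (N + N0)) z \<noteq> 0" if "z \<in> S" for N z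
      using P[of "N + N0"] nz[of N] that by blast
  qed (auto intro!: holomorphic_intros)
qed

section \<open>Coefficientwise approximation by finite products\<close>

lemma tendsto_fps_mult:
  fixes f g :: "'a::real_normed_algebra_1 fps"
  assumes "\<And>k. (\<lambda>N. fps_nth (F N) k) \<longlonglongrightarrow> fps_nth f k" "\<And>k. (\<lambda>N. fps_nth (H N) k) \<longlonglongrightarrow> fps_nth h k"
  shows "(\<lambda>N. fps_nth (F N * H N) k) \<longlonglongrightarrow> fps_nth (f * h) k"
  unfolding fps_mult_nth by (intro tendsto_intros assms)

lemma tendsto_fps_power:
  fixes f :: "'a::real_normed_field fps"
  assumes "\<And>k. (\<lambda>N. fps_nth (F N) k) \<longlonglongrightarrow> fps_nth f k"
  shows "(\<lambda>N. fps_nth (F N ^ m) k) \<longlonglongrightarrow> fps_nth (f ^ m) k"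
proof (induction m arbitrary: k)
  case (Suc m)
  show ?case unfolding power_Suc by (rule tendsto_fps_mult[OF assms Suc.IH])
qed simp

lemma one_plus_const_X_power_nth:
  fixes a :: "'a::field_char_0"
  shows "fps_nth ((1 + fps_const a * fps_X) ^ n) k = of_nat (n choose k) * a ^ k"
proof -
  have "(1 + fps_const a * fps_X) ^ n
      = (\<Sum>i\<le>n. fps_const (of_nat (n choose i) * a ^ i) * fps_X ^ i)"
    by (subst add.commute) (simp add: binomial_ring power_mult_distrib fps_const_power fps_of_nat
        mult.assoc flip: fps_const_mult)
  then have "fps_nth ((1 + fps_const a * fps_X) ^ n) k
      = (\<Sum>i\<le>n. if i = k then of_nat (n choose i) * a ^ i else 0)"
    by (simp add: fps_sum_nth fps_X_power_nth if_distrib cong: if_cong)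
  then show ?thesis by (simp add: binomial_eq_0)
qed

text \<open>Up to \<open>fact k\<close>, the coefficient of \<open>(1 + a x / n)^n\<close> is a
  product of \<open>k\<close> factors \<open>(n - i) * (a / n)\<close>, each tending to
  \<open>a\<close>.\<close>

lemma tendsto_fps_exp:
  fixes a :: real
  shows "(\<lambda>N. fps_nth ((1 + fps_const (a / real (Suc N)) * fps_X) ^ Suc N) k) \<longlonglongrightarrow> fps_nth (fps_exp a) k"
proof -
  have "fps_nth ((1 + fps_const (a / real (Suc N)) * fps_X) ^ Suc N) k
      = (\<Prod>i<k. (real (Suc N) - real i) * (a / real (Suc N))) / fact k" for N
    unfolding one_plus_const_X_power_nth binomial_gbinomial gbinomial_prod_rev prod.distrib
    by (simp add: atLeast0LessThan)
  moreover have "(\<lambda>N. (\<Prod>i<k. (real (Suc N) - real i) * (a / real (Suc N))) / fact k)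
      \<longlonglongrightarrow> (\<Prod>i<k. a) / fact k"
  proof (intro tendsto_intros)
    show "(\<lambda>N. (real (Suc N) - real i) * (a / real (Suc N))) \<longlonglongrightarrow> a" for i
      by real_asymp
  qed simp
  ultimately show ?thesis by simp
qed

lemma prod_lessThan_add:
  fixes g :: "nat \<Rightarrow> 'a::comm_monoid_mult"
  shows "(\<Prod>i<a + b. g i) = (\<Prod>i<a. g i) * (\<Prod>i<b. g (a + i))"
  by (induction b) (simp_all add: mult.assoc)

text \<open>With \<open>n = Suc N\<close>, the power \<open>x^M\<close> is replaced by
  \<open>(1/n + x)^M = n^(-M) (1 + n x)^M\<close>, the exponential by
  \<open>(1 + \<gamma> x / n)^n\<close>, and the infinite product by its first \<open>n\<close>
  factors. The scalar \<open>n^(-M)\<close> goes into \<open>c N\<close>, so \<open>c N\<close> is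
  constant when \<open>M = 0\<close>; this keeps the endpoint of the interval fixed.\<close>

lemma finite_quotient_product_approximation:
  fixes C \<gamma> :: real and \<alpha> \<beta> :: "nat \<Rightarrow> real" and M :: nat
  assumes C: "C > 0" and \<gamma>: "\<gamma> \<ge> 0" and nonneg: "\<And>i. \<alpha> i \<ge> 0" "\<And>i. \<beta> i \<ge> 0"
    and "summable (\<lambda>i. \<alpha> i + \<beta> i)"
    and f: "f = fps_const C * fps_X ^ M * fps_exp \<gamma> * fps_infprod (\<lambda>i. linear_quotient (\<alpha> i) (\<beta> i))"
  obtains c a b m where "\<And>N. finite_quotient_product (c N) (a N) (b N)"
    "\<And>k. (\<lambda>N. fps_nth (finite_quotient_product.F (c N) (a N) (b N) (m N)) k) \<longlonglongrightarrow> fps_nth f k"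
    "\<And>N. M = 0 \<Longrightarrow> c N = C"
proof
  define c where "c N = C / real (Suc N) ^ M" for N
  define a where "a N i = (if i < M then real (Suc N) else if i < M + Suc N then \<gamma> / real (Suc N)
    else \<alpha> (i - (M + Suc N)))" for N i
  define b where "b N i = (if i < M + Suc N then 0 else \<beta> (i - (M + Suc N)))" for N i
  define m where "m N = M + Suc N + Suc N" for N
  show fin: "finite_quotient_product (c N) (a N) (b N)" for N
    using C \<gamma> nonneg by unfold_locales (auto simp: c_def a_def b_def)
  have lq: "linear_quotient x 0 = 1 + fps_const x * fps_X" for x
    using linear_quotient_mult[of x 0] by simp
  have F: "finite_quotient_product.F (c N) (a N) (b N) (m N)
    = fps_const C * (fps_const (1 / real (Suc N)) + fps_X) ^ M
      * (1 + fps_const (\<gamma> / real (Suc N)) * fps_X) ^ Suc N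
      * (\<Prod>i<Suc N. linear_quotient (\<alpha> i) (\<beta> i))" for N
  proof -
    let ?n = "real (Suc N)" and ?g = "\<lambda>i. linear_quotient (a N i) (b N i)"
    have "(\<Prod>i<m N. ?g i) = (\<Prod>i<M. ?g i) * (\<Prod>i<Suc N. ?g (M + i)) * (\<Prod>i<Suc N. ?g (M + Suc N + i))"
      unfolding m_def prod_lessThan_add ..
    also have "(\<Prod>i<M. ?g i) = (\<Prod>i<M. 1 + fps_const ?n * fps_X)"
      by (intro prod.cong) (auto simp: a_def b_def lq)
    also have "(\<Prod>i<Suc N. ?g (M + i)) = (\<Prod>i<Suc N. 1 + fps_const (\<gamma> / ?n) * fps_X)"
      by (intro prod.cong) (auto simp: a_def b_def lq)
    also have "(\<Prod>i<Suc N. ?g (M + Suc N + i)) = (\<Prod>i<Suc N. linear_quotient (\<alpha> i) (\<beta> i))"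
      by (intro prod.cong) (auto simp: a_def b_def)
    also have "fps_const (c N) * ((\<Prod>i<M. 1 + fps_const ?n * fps_X)
        * (\<Prod>i<Suc N. 1 + fps_const (\<gamma> / ?n) * fps_X) * (\<Prod>i<Suc N. linear_quotient (\<alpha> i) (\<beta> i)))
      = fps_const C * (fps_const ((1 / ?n) ^ M) * (1 + fps_const ?n * fps_X) ^ M)
        * (1 + fps_const (\<gamma> / ?n) * fps_X) ^ Suc N * (\<Prod>i<Suc N. linear_quotient (\<alpha> i) (\<beta> i))"
    proof -
      have "fps_const (c N) = fps_const C * fps_const ((1 / ?n) ^ M)"
        by (simp add: c_def power_divide)
      then show ?thesis by (simp only: prod_constant card_lessThan mult.assoc)
    qed
    also have "fps_const ((1 / ?n) ^ M) * (1 + fps_const ?n * fps_X) ^ M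
        = (fps_const (1 / ?n) + fps_X) ^ M"
    proof -
      have "fps_const (1 / ?n) * (1 + fps_const ?n * fps_X) = fps_const (1 / ?n) + fps_X"
        by (simp add: distrib_left del: of_nat_Suc flip: mult.assoc)
      then show ?thesis
        by (metis fps_const_power power_mult_distrib)
    qed
    finally show ?thesis
      unfolding finite_quotient_product.F_def[OF fin] finite_quotient_product.G_def[OF fin] .
  qed
  have "(\<lambda>N. fps_nth (fps_const (1 / real (Suc N)) + fps_X) k) \<longlonglongrightarrow> fps_nth fps_X k" for k
  proof -
    have "(\<lambda>N. 1 / real (Suc N)) \<longlonglongrightarrow> 0" by real_asymp
    then show ?thesis by (cases k) (auto intro!: tendsto_eq_intros)
  qed
  moreover have "(\<lambda>N. fps_nth (\<Prod>i<Suc N. linear_quotient (\<alpha> i) (\<beta> i)) k)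
      \<longlonglongrightarrow> fps_nth (fps_infprod (\<lambda>i. linear_quotient (\<alpha> i) (\<beta> i))) k" for k
    using fps_infprod_LIMSEQ[OF nonneg \<open>summable _\<close>]
    unfolding linear_quotient_def by (rule LIMSEQ_Suc)
  ultimately show "(\<lambda>N. fps_nth (finite_quotient_product.F (c N) (a N) (b N) (m N)) k)
      \<longlonglongrightarrow> fps_nth f k" for k
    unfolding F f by (intro tendsto_fps_mult tendsto_fps_power tendsto_fps_exp tendsto_const)
  show "c N = C" if "M = 0" for N
    using that by (simp add: c_def)
qed

lemma real_rooted_0_1: "real_rooted 0" "real_rooted 1"
  by (simp_all add: real_rooted_def)

theorem theorem4p4:
  fixes C \<gamma> :: real and \<alpha> \<beta> :: "nat \<Rightarrow> real" and M :: nat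
    and f :: "real fps" and r :: "nat \<Rightarrow> real poly"
  assumes "C \<ge> 0" and "\<gamma> \<ge> 0"
    and "\<And>i. \<alpha> i \<ge> 0" and "\<And>i. \<beta> i \<ge> 0"
    and "summable (\<lambda>i. \<alpha> i + \<beta> i)"
    and "f = fps_const C * fps_X ^ M * fps_exp \<gamma> *
          fps_infprod (\<lambda>i. (1 + fps_const (\<alpha> i) * fps_X) / (1 - fps_const (\<beta> i) * fps_X))"
    and "\<And>n. r n = fps_nth (r_series f) n"
  shows "(\<forall>n. real_rooted (r n) \<and> r n \<prec> r (n + 1)) \<and>
    (fps_nth f 0 \<noteq> 0 \<longrightarrow>
      (\<forall>n. r n \<noteq> 0 \<longrightarrow>
        (\<forall>z. poly (map_poly complex_of_real (r n)) z = 0 \<longrightarrow>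
          z \<in> complex_of_real ` {- 1 / fps_nth f 0 .. 0})))"
\<comment> \<open>The finite products require a positive constant; for \<open>C = 0\<close> the
  series \<open>f\<close> is 0 and \<open>r\<close> is 1 followed by zeros.\<close>
proof (cases "C = 0")
  case True
  then have "f = 0" using assms(6) by simp
  then have "r 0 = 1" "r (Suc n) = 0" for n
    by (simp_all add: assms(7) r_series_0 r_series_Suc)
  then have "r n = 1 \<or> r n = 0" "r (n + 1) = 0" for n
    by (cases n; simp)+
  then have "real_rooted (r n)" "r (n + 1) = 0" for n
    using real_rooted_0_1 by metis+
  then show ?thesis
    using \<open>f = 0\<close> by (auto simp: interlaces_def real_rooted_0_1)
next
  case False
  with assms(1) have C: "C > 0" by simp
  obtain c a b m where fin: "\<And>N. finite_quotient_product (c N) (a N) (b N)"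
    and lim: "\<And>k. (\<lambda>N. fps_nth (finite_quotient_product.F (c N) (a N) (b N) (m N)) k)
       \<longlonglongrightarrow> fps_nth f k"
    and cC: "\<And>N. M = 0 \<Longrightarrow> c N = C"
    using finite_quotient_product_approximation[OF C assms(2-5), of f M] assms(6)
    unfolding linear_quotient_def by blast
  define F where "F N = finite_quotient_product.F (c N) (a N) (b N) (m N)" for N
  note deg = degree_r_series_le[of "F _"] degree_r_series_le[of f]
  have coeff_lim: "(\<lambda>N. coeff (fps_nth (r_series (F N)) n) k) \<longlonglongrightarrow> coeff (r n) k" for n k
    unfolding assms(7) F_def by (rule tendsto_coeff_r_series[OF lim])
  have f_nonneg: "fps_nth f k \<ge> 0" for k
    by (rule LIMSEQ_le_const[OF lim]) (use finite_quotient_product.F_nonneg[OF fin] in blast)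
  have lc: "lead_coeff (r n) > 0" if "r n \<noteq> 0" for n
    using lead_coeff_r_series_pos[OF f_nonneg] that unfolding assms(7) by blast
  have rr: "real_rooted (r n)" for n
    unfolding real_rooted_iff_upper
  proof (intro disjCI allI impI)
    fix z assume "\<not> (\<forall>z. Im z > 0 \<longrightarrow> cpoly (r n) z \<noteq> 0)"
    show "r n = 0"
    proof (rule ccontr)
      assume nz: "r n \<noteq> 0"
      have "cpoly (r n) z \<noteq> 0" if "z \<in> {z. Im z > 0}" for z
      proof (rule limit_nonzero[of "\<lambda>N. fps_nth (r_series (F N)) n" n "r n" "{z. Im z > 0}"])
        show "fps_nth (r_series (F N)) n = 0
            \<or> (\<forall>z\<in>{z. Im z > 0}. cpoly (fps_nth (r_series (F N)) n) z \<noteq> 0)" for N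
          using finite_quotient_product.r_nonzero_upper[OF fin] unfolding F_def by blast
      qed (use nz that deg coeff_lim convex_connected[OF convex_halfspace_Im_gt] in
          \<open>auto simp: assms(7) open_halfspace_Im_gt\<close>)
      with \<open>\<not> (\<forall>z. Im z > 0 \<longrightarrow> cpoly (r n) z \<noteq> 0)\<close> show False by blast
    qed
  qed
  have "r n \<prec> r (n + 1)" for n
  proof (cases "r n = 0 \<or> r (n + 1) = 0")
    case True
    then show ?thesis using rr by (auto simp: interlaces_def)
  next
    case False
    show ?thesis
    proof (rule interlacesI_upper_half_plane)
      fix z :: complex assume z: "Im z > 0"
      have "(\<lambda>N. cpoly (fps_nth (r_series (F N)) n) z) \<longlonglongrightarrow> cpoly (r n) z" for n
        by (rule tendsto_cpoly[OF deg(1) _ coeff_lim]) (simp add: assms(7) deg)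
      then have "(\<lambda>N. Im (cpoly (fps_nth (r_series (F N)) (n + 1)) z
          * cnj (cpoly (fps_nth (r_series (F N)) n) z))) \<longlonglongrightarrow> Im (cpoly (r (n + 1)) z * cnj (cpoly (r n) z))"
        by (intro tendsto_intros)
      then show "Im (cpoly (r (n + 1)) z * cnj (cpoly (r n) z)) \<ge> 0"
        by (rule LIMSEQ_le_const)
          (use finite_quotient_product.r_consecutive[OF fin z] in \<open>auto simp: F_def\<close>)
    qed (use False rr lc in auto)
  qed
  moreover have "z \<in> complex_of_real ` {- 1 / fps_nth f 0 .. 0}"
    if f0: "fps_nth f 0 \<noteq> 0" and nz: "r n \<noteq> 0" and z: "cpoly (r n) z = 0" for n z
  proof -
    \<comment> \<open>A nonzero \<open>f(0)\<close> excludes a power of \<open>x\<close>, so every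
      approximant has constant term \<open>C = f(0)\<close> and the half-plane
      \<open>Re z < - 1 / C\<close> is the same for all of them.\<close>
    have "M = 0"
      using f0 unfolding assms(6) by (cases M) auto
    then have "fps_nth f 0 = C"
      using lim[of 0] cC finite_quotient_product.F_nth_0[OF fin] by (simp add: LIMSEQ_const_iff)
    obtain x where x: "z = of_real x"
      using rr[of n] nz z unfolding real_rooted_def by (auto elim: Reals_cases)
    \<comment> \<open>With nonnegative coefficients, the value at a positive point is at least the
      leading term.\<close>
    have "\<not> x > 0"
    proof
      assume "x > 0"
      have "0 < lead_coeff (r n) * x ^ degree (r n)"
        using lc[OF nz] \<open>x > 0\<close> by simp
      also have "\<dots> \<le> poly (r n) x"
        unfolding poly_altdef using coeff_r_series_nonneg[OF f_nonneg] \<open>x > 0\<close>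
        by (intro member_le_sum) (auto simp: assms(7))
      finally show False using z unfolding x cpoly_of_real by simp
    qed
    moreover have "\<not> x < - 1 / C"
    proof
      assume "x < - 1 / C"
      have "cpoly (r n) z \<noteq> 0"
      proof (rule limit_nonzero[of "\<lambda>N. fps_nth (r_series (F N)) n" n "r n" "{z. Re z < - 1 / C}"])
        show "fps_nth (r_series (F N)) n = 0
            \<or> (\<forall>z\<in>{z. Re z < - 1 / C}. cpoly (fps_nth (r_series (F N)) n) z \<noteq> 0)" for N
          using finite_quotient_product.r_nonzero_left[OF fin[of N], of "m N" n] cC[OF \<open>M = 0\<close>]
          unfolding F_def by auto
      qed (use nz \<open>x < - 1 / C\<close> deg coeff_lim convex_connected[OF convex_halfspace_Re_lt] in
          \<open>auto simp: assms(7) open_halfspace_Re_lt x\<close>)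
      with z show False by simp
    qed
    ultimately show ?thesis
      unfolding x \<open>fps_nth f 0 = C\<close> by auto
  qed
  ultimately show ?thesis using rr by blast
qed

end
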